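(* Let $s,q$ be integers. (i) If $s\le q\le s+2$, then for all integers $s>1$ and all sufficiently large integers $n$, every extremal graph which maximizes the number of proper $q$-colorings over graphs with $n$ vertices and $\frac{s-1}{2s}n^2+o(n^2)$ edges is $o(n^2)$-close to the Turán graph $T_s(n)$. (ii) If $s+3\le q\le 2s-7$, where $s\ge 10$ is an integer, then Lazebnik's conjecture is false for $(s,q)$.
   Context: Graphs are finite and simple. $P_G(q)$ denotes the number of proper $q$-colorings of $G$. $T_s(n)$ denotes the complete $s$-partite graph on $n$ vertices with nearly equal parts (sizes differing by at most one). The edit distance of two graphs with the same number of vertices is the minimum number of edges that need to be added or deleted from one graph to make it isomorphic to the other. $G$ is $d$-close to $H$ if their edit distance is at most $d$. "Extremal" means: $G$ has the maximum number of proper $q$-colorings among all graphs with the same number of vertices and the same number of edges as $G$. Asymptotic notation is as $n\to\infty$ with $s,q$ fixed: the conclusion of (i) means that for every $\varepsilon>0$ there are $\eta>0$ and $n_0$ such that for every $n\ge n_0$, every extremal $n$-vertex graph whose number of edges differs from $\frac{s-1}{2s}n^2$ by at most $\eta n^2$ is $\varepsilon n^2$-close to $T_s(n)$. Lazebnik's conjecture for a pair of integers $(s,q)$ with $q\ge s>1$ is the assertion: for every positive integer $n$ divisible by $s$, the Turán graph $T_s(n)$ has more proper $q$-colorings than any other graph with the same number of vertices and edges. Thus it is false for $(s,q)$ if there are $n$ divisible by $s$ and a graph $G$, not isomorphic to $T_s(n)$, with $n$ vertices and the same number of edges as $T_s(n)$, such that $P_G(q)\ge P_{T_s(n)}(q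)$.
   Formalization: In (i), when q = s, the extremal graph is additionally assumed to have at least one proper q-coloring; otherwise every graph with slightly more edges than T_s(n) has no q-coloring, is vacuously extremal, and the claim fails. *)

theory Defs
  imports Complex_Main "HOL-Library.FuncSet"
begin

text \<open>Finite simple graphs: an edge is a two-element set of vertices.\<close>

record 'a ugraph =
  verts :: "'a set"
  edges :: "'a set set"

definition simple_graph :: "'a ugraph \<Rightarrow> bool" where
  "simple_graph G \<longleftrightarrow>
     finite (verts G) \<and> (\<forall>e\<in>edges G. e \<subseteq> verts G \<and> card e = 2)"

definition graph_iso :: "'a ugraph \<Rightarrow> 'b ugraph \<Rightarrow> bool" where
  "graph_iso G H \<longleftrightarrow>
     (\<exists>f. bij_betw f (verts G) (verts H) \<and> (\<lambda>e. f ` e) ` edges G = edges H)"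

text \<open>\<open>proper_colorings q G\<close> uses the colours \<open>0, \<dots>, q - 1\<close>; colourings are extensional
  functions on the vertex set, so that each one is counted exactly once.\<close>

definition proper_colorings :: "nat \<Rightarrow> 'a ugraph \<Rightarrow> ('a \<Rightarrow> nat) set" where
  "proper_colorings q G =
     {c \<in> verts G \<rightarrow>\<^sub>E {..<q}. \<forall>u v. {u, v} \<in> edges G \<longrightarrow> c u \<noteq> c v}"

definition num_colorings :: "'a ugraph \<Rightarrow> nat \<Rightarrow> nat" where
  "num_colorings G q = card (proper_colorings q G)"

definition extremal :: "nat \<Rightarrow> 'a ugraph \<Rightarrow> bool" where
  "extremal q G \<longleftrightarrow> simple_graph G \<and>
     (\<forall>H :: 'a ugraph. simple_graph H \<and> card (verts H) = card (verts G) \<and>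
        card (edges H) = card (edges G) \<longrightarrow> num_colorings H q \<le> num_colorings G q)"

text \<open>The complete multipartite graph on \<open>V\<close> whose parts are the fibres of \<open>part\<close>.\<close>

definition complete_multipartite :: "'a set \<Rightarrow> ('a \<Rightarrow> 'b) \<Rightarrow> 'a ugraph" where
  "complete_multipartite V part =
     \<lparr>verts = V, edges = {{u, v} | u v. u \<in> V \<and> v \<in> V \<and> part u \<noteq> part v}\<rparr>"

text \<open>The parts of the Turan graph \<open>T\<^sub>s(n)\<close> are the residue classes modulo \<open>s\<close> in
  \<open>{0, \<dots>, n - 1}\<close>; lemma \<open>card_turan_part\<close> confirms that they are nearly equal.\<close>

definition turan_graph :: "nat \<Rightarrow> nat \<Rightarrow> nat ugraph" where
  "turan_graph s n = complete_multipartite {..<n} (\<lambda>v. v mod s)"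

lemma simple_graph_turan_graph: "simple_graph (turan_graph s n)"
  by (auto simp: simple_graph_def turan_graph_def complete_multipartite_def card_2_iff)

lemma card_turan_part:
  assumes "i < s"
  shows "card {v \<in> {..<n}. v mod s = i} = n div s + (if i < n mod s then 1 else 0)"
proof -
  have "{v \<in> {..<n}. v mod s = i} = (\<lambda>k. k * s + i) ` {k. k * s + i < n}"
  proof (intro set_eqI iffI)
    fix v assume "v \<in> {v \<in> {..<n}. v mod s = i}"
    then have "v = (v div s) * s + i" "v < n"
      by auto
    then show "v \<in> (\<lambda>k. k * s + i) ` {k. k * s + i < n}"
      by (metis (mono_tags, lifting) image_eqI mem_Collect_eq)
  qed (use assms in auto)
  moreover have "{k. k * s + i < n} = {..<n div s + (if i < n mod s then 1 else 0)}"
  proof (intro set_eqI)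
    fix k
    have n: "n = (n div s) * s + n mod s" "n mod s < s"
      using assms by auto
    have "k * s + i < (n div s) * s + n mod s \<longleftrightarrow>
        k < n div s \<or> (k = n div s \<and> i < n mod s)"
    proof (cases k "n div s" rule: linorder_cases)
      case less
      then have "Suc k * s \<le> (n div s) * s"
        by (intro mult_right_mono) auto
      then have "k * s + i < (n div s) * s + n mod s"
        using assms unfolding mult_Suc by linarith
      then show ?thesis
        using less by blast
    next
      case greater
      then have "Suc (n div s) * s \<le> k * s"
        by (intro mult_right_mono) auto
      then have "(n div s) * s + n mod s \<le> k * s + i"
        using n(2) unfolding mult_Suc by linarith
      then show ?thesis
        using greater by linarith
    next
      case equal
      then show ?thesis
        by (metis add_less_cancel_left less_irrefl)
    qed
    then show "k \<in> {k. k * s + i < n} \<longleftrightarrow>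
        k \<in> {..<n div s + (if i < n mod s then 1 else 0)}"
      using n(1) by auto
  qed
  moreover have "inj (\<lambda>k. k * s + i)"
    using assms by (auto intro: injI)
  ultimately show ?thesis
    by (simp add: card_image inj_on_subset)
qed

text \<open>The least number of edges to be added to or deleted from \<open>G\<close> to make it isomorphic to
  \<open>H\<close>. This is meaningful only if \<open>G\<close> and \<open>H\<close> have equally many vertices, which
  \<open>close_to\<close> therefore requires.\<close>

definition edit_distance :: "'a ugraph \<Rightarrow> 'b ugraph \<Rightarrow> nat" where
  "edit_distance G H = (LEAST d. \<exists>F. simple_graph \<lparr>verts = verts G, edges = F\<rparr> \<and>
     graph_iso \<lparr>verts = verts G, edges = F\<rparr> H \<and>
     d = card ((edges G - F) \<union> (F - edges G)))"

definition close_to :: "real \<Rightarrow> 'a ugraph \<Rightarrow> 'b ugraph \<Rightarrow> bool" where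
  "close_to d G H \<longleftrightarrow>
     card (verts G) = card (verts H) \<and> real (edit_distance G H) \<le> d"

text \<open>Graphs are considered up to isomorphism, so natural numbers suffice as vertices and the
  ``other'' graphs are those not isomorphic to \<open>T\<^sub>s(n)\<close>.\<close>

definition lazebnik_conjecture :: "nat \<Rightarrow> nat \<Rightarrow> bool" where
  "lazebnik_conjecture s q \<longleftrightarrow>
     (\<forall>n>0. s dvd n \<longrightarrow>
       (\<forall>G :: nat ugraph. simple_graph G \<and> card (verts G) = n \<and>
          card (edges G) = card (edges (turan_graph s n)) \<and>
          \<not> graph_iso G (turan_graph s n) \<longrightarrow>
          num_colorings G q < num_colorings (turan_graph s n) q))"

end

theory Submission
  imports Defs "HOL-Analysis.Convex" "HOL-Real_Asymp.Real_Asymp"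
begin

text \<open>
  Write \<open>b = q - s\<close>.

  Part (i). Call two vertices in conflict if they carry lists of colours that intersect. Every
  independent set of a graph lies in a container, a set of vertices that spans few edges and is
  determined by boundedly many vertices of the independent set. Applied to the colour classes this
  yields, up to a factor polynomial in \<open>n\<close>, a single assignment of lists \<open>L v\<close> such that
  \<open>num_colorings G q\<close> is at most the product of their sizes and only few edges join conflicting
  vertices (lemma \<open>container_lists\<close>). A comparison with a graph slightly denser than the Turan graph
  (lemma \<open>extremal_many_colorings\<close>) shows that an extremal graph has at least
  \<open>2 powr (b * n / s - o(n))\<close> colourings. Since a list of size \<open>k\<close> satisfies \<open>k \<le> 2 ^ (k - 1)\<close>, the
  total excess \<open>\<Sum>v. card (L v) - 1\<close> is at least \<open>b * n / s - o(n)\<close>, whereas the number of edges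
  leaves room for at most \<open>n\<^sup>2 / s + o(n\<^sup>2)\<close> conflicting ordered pairs.

  These two bounds pin down the lists. Let \<open>d i\<close> be the proportion of vertices whose list
  contains the colour \<open>i\<close>, order the colours by decreasing \<open>d\<close>, let the first colour of \<open>L v\<close>
  represent \<open>v\<close>, and let \<open>a i\<close> be the proportion of vertices whose list contains \<open>i\<close> but which are
  represented by another colour. Two vertices conflict if the representative of one belongs to the
  list of the other, and because the representatives respect one linear order such a pair has only
  one colour as a witness; so the conflict density is at least \<open>\<Sum>i. (d i)\<^sup>2 - (a i)\<^sup>2\<close>
  (lemma \<open>conflicts_ge_class_squares\<close>). With \<open>b * z = (\<Sum>i. a i)\<close>, the normalised excess, there is
  the identity
    \<open>(\<Sum>i. (d i)\<^sup>2 - (a i)\<^sup>2) - 2 * z + s * z\<^sup>2 = (\<Sum>i. (d i - z)\<^sup>2 + a i * (z - a i))\<close>,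
  and the left side is bounded above by a small quantity when \<open>z\<close> is close to \<open>1 / s\<close>. For \<open>b = 1\<close> no \<open>a i\<close> exceeds
  \<open>z\<close>, so all terms on the right are nonnegative and hence small. For \<open>b = 2\<close> at most one does,
  say \<open>a i = z + e\<close>; the loss is then made up by \<open>(d i - z)\<^sup>2 \<ge> e\<^sup>2\<close>, by the same bound for a colour
  that precedes \<open>i\<close>, and by the other terms \<open>a j * (z - a j)\<close>, where \<open>a j \<le> z - e\<close>;
  as the deviations \<open>d j - z\<close> add up to almost \<open>0\<close>, moreover, \<open>e\<close> has to be small. For \<open>b \<ge> 3\<close>
  this balance fails. It follows that every \<open>d i\<close> is close to \<open>z\<close> and every \<open>a i\<close> close to \<open>0\<close>
  or \<open>z\<close>; as the \<open>a i\<close> add up to \<open>b * z\<close>, some \<open>b\<close> of the colours represent almost no vertex, and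
  the other \<open>s\<close> colours split almost all of \<open>G\<close> into \<open>s\<close> classes in which all pairs
  conflict (lemma \<open>list_stability\<close>). These classes contain few edges, and a graph with that many
  edges and such a partition is close to the Turan graph (lemma \<open>close_to_turan_if_partition\<close>).

  Part (ii). Each colouring of the Turan graph on \<open>s * t\<close> vertices distributes the colours among
  the parts, so their number is at most a constant times \<open>2 ^ (b * t)\<close>. A competitor has \<open>s + 1\<close>
  parts: \<open>j = b - 1\<close> parts of size \<open>x\<close> with two colours each and \<open>l = s + 1 - j\<close> parts of size
  \<open>w < x\<close> with one colour each. It has one two-coloured part less, but its sizes may be unequal: it
  has enough edges if \<open>s * (j * x\<^sup>2 + l * w\<^sup>2) \<le> (j * x + l * w)\<^sup>2\<close>, and exponentially more
  colourings if \<open>j * x\<close> exceeds \<open>b * t\<close> by a positive proportion. Both can be met if \<open>j \<ge> 2\<close> and \<open>l \<ge> 9\<close>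
  (lemma \<open>good_part_sizes\<close>), which is the hypothesis \<open>s + 3 \<le> q \<le> 2 * s - 7\<close>.
\<close>

section \<open>A stability inequality for colour frequencies\<close>

text \<open>
  The quantitative form of the identity and the balance described at the beginning of the theory, for
  total mass 1. The assumption on the colour \<open>j\<close> holds when the representatives are chosen by
  decreasing \<open>d\<close>: a colour that loses a vertex loses it to a colour that is at least as frequent.
\<close>

lemma near_uniform:
  fixes d a :: "nat \<Rightarrow> real" and z \<rho> :: real and s b q :: nat
  assumes b: "b = 1 \<or> b = 2" and q: "q = s + b" and s: "2 \<le> s" and rho: "0 < \<rho>" "\<rho> \<le> 1"
    and a0: "\<And>i. i < q \<Longrightarrow> 0 \<le> a i" and ad: "\<And>i. i < q \<Longrightarrow> a i \<le> d i"
    and twin: "\<And>i. i < q \<Longrightarrow> 0 < a i \<Longrightarrow> \<exists>j<q. j \<noteq> i \<and> d i \<le> d j"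
    and total: "(\<Sum>i<q. d i - a i) = 1" and suma: "(\<Sum>i<q. a i) = b * z"
    and z: "\<bar>1 - s * z\<bar> \<le> \<rho> / 2"
    and sq: "(\<Sum>i<q. (d i)\<^sup>2 - (a i)\<^sup>2) \<le> 1 / s + \<rho>\<^sup>2 / 2"
  shows "\<forall>i<q. \<bar>d i - z\<bar> \<le> 2 * s * \<rho> \<and> a i * (z - a i) \<le> 3 * s * \<rho>"
proof -
  define T where "T i = (d i - z)\<^sup>2 + a i * (z - a i)" for i
  have sumd: "(\<Sum>i<q. d i) = 1 + b * z"
    using total suma by (simp add: sum_subtractf)
  have dev: "(\<Sum>i<q. d i - z) = 1 - s * z"
    using sumd q by (simp add: sum_subtractf algebra_simps)
  have "(\<Sum>i<q. T i) = (\<Sum>i<q. (d i)\<^sup>2 - (a i)\<^sup>2) - 2 * z * (\<Sum>i<q. d i) + q * z\<^sup>2 + z * (\<Sum>i<q. a i)"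
    unfolding T_def
    by (simp add: sum.distrib sum_subtractf sum_distrib_left power2_eq_square algebra_simps)
  also have "\<dots> = (\<Sum>i<q. (d i)\<^sup>2 - (a i)\<^sup>2) - 2 * z + s * z\<^sup>2"
    unfolding sumd suma using q by (simp add: algebra_simps power2_eq_square)
  also have "\<dots> = (\<Sum>i<q. (d i)\<^sup>2 - (a i)\<^sup>2) - 1 / s + (1 - s * z)\<^sup>2 / s"
    using s by (simp add: field_simps power2_eq_square)
  also have "\<dots> \<le> \<rho>\<^sup>2"
  proof -
    have "(1 - s * z)\<^sup>2 \<le> (\<rho> / 2)\<^sup>2" using z by (rule power2_le_iff_abs_le[THEN iffD2, rotated]) (use rho in auto)
    then have "(1 - s * z)\<^sup>2 / s \<le> (\<rho> / 2)\<^sup>2 / 1"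
      using s by (intro frac_le) auto
    also have "\<dots> \<le> \<rho>\<^sup>2 / 2" by (simp add: power2_eq_square)
    finally show ?thesis using sq by (simp add: field_simps)
  qed
  finally have sumT: "(\<Sum>i<q. T i) \<le> \<rho>\<^sup>2" .
  have sz: "s * z \<le> 3 / 2" "1 / 2 \<le> s * z" using z rho by linarith+
  have z0: "0 < z"
  proof (rule ccontr)
    assume "\<not> 0 < z"
    then have "s * z \<le> 0" by (simp add: mult_nonneg_nonpos)
    then show False using sz by linarith
  qed
  have z1: "z \<le> 3 / 4"
  proof -
    have "2 * z \<le> s * z" using s z0 by (intro mult_right_mono) auto
    then show ?thesis using sz by linarith
  qed
  have rs: "\<rho>\<^sup>2 \<le> s * \<rho> / 2"
  proof -
    have "\<rho> * \<rho> \<le> 1 * \<rho>" using rho by (intro mult_right_mono) auto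
    moreover have "2 * \<rho> \<le> s * \<rho>" using s rho by (intro mult_right_mono) auto
    ultimately show ?thesis by (simp add: power2_eq_square)
  qed
  have srho: "0 < s * \<rho>" using s rho by simp
  show ?thesis
  proof (cases "\<forall>i<q. a i \<le> z")
    case True
    have T0: "0 \<le> T i" "(d i - z)\<^sup>2 \<le> T i" "a i * (z - a i) \<le> T i" if "i < q" for i
      using True that a0[OF that] unfolding T_def by auto
    show ?thesis
    proof (intro allI impI)
      fix i assume i: "i < q"
      have "T i \<le> (\<Sum>i<q. T i)" using i T0 by (intro member_le_sum) auto
      then have Ti: "T i \<le> \<rho>\<^sup>2" using sumT by linarith
      then have "(d i - z)\<^sup>2 \<le> \<rho>\<^sup>2" using T0[OF i] by linarith
      then have "\<bar>d i - z\<bar> \<le> \<rho>" using rho by (simp add: power2_le_iff_abs_le)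
      moreover have "1 * \<rho> \<le> s * \<rho>" using s rho by (intro mult_right_mono) auto
      moreover have "a i * (z - a i) \<le> \<rho>\<^sup>2" using Ti T0[OF i] by linarith
      ultimately show "\<bar>d i - z\<bar> \<le> 2 * s * \<rho> \<and> a i * (z - a i) \<le> 3 * s * \<rho>"
        using rs srho by auto
    qed
  next
    case False
    then obtain i0 where i0: "i0 < q" "z < a i0" by force
    define e where "e = a i0 - z"
    have e0: "0 < e" using i0 e_def by simp
    \<comment> \<open>The remaining \<open>a i\<close> share \<open>(b - 1) * z - e\<close>, which is nonnegative only if \<open>b = 2\<close>.\<close>
    have rest: "(\<Sum>i\<in>{..<q} - {i0}. a i) = b * z - z - e"
      using suma i0 by (simp add: sum.remove[of "{..<q}" i0] e_def)
    moreover have "0 \<le> (\<Sum>i\<in>{..<q} - {i0}. a i)" using a0 by (intro sum_nonneg) auto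
    ultimately have b2: "b = 2" using b e0 by auto
    have ez: "e \<le> z" using rest b2 \<open>0 \<le> (\<Sum>i\<in>{..<q} - {i0}. a i)\<close> by simp
    have aj: "a j \<le> z - e" if "j < q" "j \<noteq> i0" for j
    proof -
      have "a j \<le> (\<Sum>i\<in>{..<q} - {i0}. a i)" using that a0 by (intro member_le_sum) auto
      then show ?thesis using rest b2 by simp
    qed
    have cross: "e * (z - e) \<le> (\<Sum>i\<in>{..<q} - {i0}. a i * (z - a i))"
    proof -
      have "e * (z - e) = (\<Sum>i\<in>{..<q} - {i0}. a i * e)"
        unfolding sum_distrib_right[symmetric] rest using b2 by (simp add: algebra_simps)
      also have "\<dots> \<le> (\<Sum>i\<in>{..<q} - {i0}. a i * (z - a i))"
        using aj a0 by (intro sum_mono mult_left_mono) (auto simp: algebra_simps)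
      finally show ?thesis .
    qed
    have "(\<Sum>i<q. T i) = (\<Sum>i<q. (d i - z)\<^sup>2) + (a i0 * (z - a i0) + (\<Sum>i\<in>{..<q} - {i0}. a i * (z - a i)))"
      unfolding T_def sum.distrib using i0 by (simp add: sum.remove[of "{..<q}" i0])
    moreover have "a i0 * (z - a i0) = - (z + e) * e" by (simp add: e_def algebra_simps)
    ultimately have D: "(\<Sum>i<q. (d i - z)\<^sup>2) \<le> \<rho>\<^sup>2 + 2 * e\<^sup>2"
      using cross sumT by (simp add: algebra_simps power2_eq_square)
    obtain j0 where j0: "j0 < q" "j0 \<noteq> i0" "d i0 \<le> d j0" using twin[of i0] i0 z0 by auto
    have P: "e \<le> d i0 - z" using ad[OF i0(1)] e_def by simp
    then have Q: "e \<le> d j0 - z" using j0 by simp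
    define J where "J = {..<q} - {i0} - {j0}"
    have cJ: "card J = s" using i0 j0 b2 q by (simp add: J_def)
    have split: "(\<Sum>i<q. f i) = f i0 + (f j0 + (\<Sum>i\<in>J. f i))" for f :: "nat \<Rightarrow> real"
      using i0 j0 by (simp add: sum.remove[of "{..<q}" i0] sum.remove[of "{..<q} - {i0}" j0] J_def)
    \<comment> \<open>The squares for \<open>i0\<close> and \<open>j0\<close> use up the term \<open>2 * e\<^sup>2\<close> of the bound \<open>D\<close>.\<close>
    have "e\<^sup>2 \<le> (d i0 - z)\<^sup>2" "e\<^sup>2 \<le> (d j0 - z)\<^sup>2"
      using P Q e0 by (auto intro!: power_mono)
    then have "(\<Sum>i\<in>J. (d i - z)\<^sup>2) \<le> \<rho>\<^sup>2" using D split[of "\<lambda>i. (d i - z)\<^sup>2"] by linarith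
    then have "s * (\<Sum>i\<in>J. (d i - z)\<^sup>2) \<le> s * \<rho>\<^sup>2" by (intro mult_left_mono) auto
    then have cs: "(\<Sum>i\<in>J. d i - z)\<^sup>2 \<le> s * \<rho>\<^sup>2"
      using sum_squared_le_sum_of_squares[of "\<lambda>i. d i - z" J] cJ by (simp add: mult.commute)
    have sJ: "(\<Sum>i\<in>J. d i - z) \<le> \<rho> / 2 - 2 * e"
      using dev split[of "\<lambda>i. d i - z"] P Q z by linarith
    \<comment> \<open>The deviations \<open>d i - z\<close> add up to almost \<open>0\<close>, but those of \<open>i0\<close> and \<open>j0\<close> are at least \<open>e\<close>.
      So the other \<open>s\<close> colours deviate by about \<open>- 2 * e\<close> or less in total, and the sum of their
      squares would be too large if \<open>e > s * \<rho>\<close>.\<close>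
    have es: "e \<le> s * \<rho>"
    proof (rule ccontr)
      assume "\<not> e \<le> s * \<rho>"
      moreover have "2 * \<rho> \<le> s * \<rho>" using s rho by (intro mult_right_mono) auto
      ultimately have "s * \<rho> < - (\<Sum>i\<in>J. d i - z)" using sJ rho by linarith
      then have "(s * \<rho>)\<^sup>2 < (- (\<Sum>i\<in>J. d i - z))\<^sup>2"
        using srho by (intro power_strict_mono) auto
      then have "(s * \<rho>)\<^sup>2 < s * \<rho>\<^sup>2" using cs by simp
      moreover have "1 * (s * \<rho>\<^sup>2) \<le> s * (s * \<rho>\<^sup>2)" using s by (intro mult_right_mono) auto
      moreover have "(s * \<rho>)\<^sup>2 = s * (s * \<rho>\<^sup>2)" by (simp add: power2_eq_square)
      ultimately show False by linarith
    qed
    have e2: "e\<^sup>2 \<le> (s * \<rho>)\<^sup>2" using es e0 by (intro power_mono) auto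
    have r2: "\<rho>\<^sup>2 \<le> (s * \<rho>)\<^sup>2"
    proof (intro power_mono)
      have "1 * \<rho> \<le> s * \<rho>" using s rho by (intro mult_right_mono) auto
      then show "\<rho> \<le> s * \<rho>" by simp
    qed (use rho in auto)
    show ?thesis
    proof (intro allI impI conjI)
      fix i assume i: "i < q"
      have "(d i - z)\<^sup>2 \<le> (\<Sum>i<q. (d i - z)\<^sup>2)" using i by (intro member_le_sum) auto
      also have "\<dots> \<le> 4 * (s * \<rho>)\<^sup>2" using D e2 r2 zero_le_power2[of "s * \<rho>"] by linarith
      also have "\<dots> = (2 * s * \<rho>)\<^sup>2" by (simp add: power_mult_distrib)
      finally have "\<bar>d i - z\<bar> \<le> \<bar>2 * s * \<rho>\<bar>" by (simp only: abs_le_square_iff)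
      moreover have "\<bar>2 * s * \<rho>\<bar> = 2 * s * \<rho>" using rho by (simp add: abs_mult)
      ultimately show "\<bar>d i - z\<bar> \<le> 2 * s * \<rho>" by linarith
      show "a i * (z - a i) \<le> 3 * s * \<rho>"
      proof (cases "i = i0")
        case True
        then have "a i * (z - a i) \<le> 0" using i0 z0 by (intro mult_nonneg_nonpos) auto
        then show ?thesis using srho by linarith
      next
        case False
        have T0: "0 \<le> T j" if "j \<in> {..<q} - {i0}" for j
          using aj[of j] that a0[of j] e0 unfolding T_def by auto
        have "T i \<le> (\<Sum>i\<in>{..<q} - {i0}. T i)" using False i T0 by (intro member_le_sum) auto
        also have "\<dots> = (\<Sum>i<q. T i) - T i0" using i0 by (simp add: sum.remove[of "{..<q}" i0])
        also have "\<dots> \<le> \<rho>\<^sup>2 + (z + e) * e"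
        proof -
          have "T i0 = (d i0 - z)\<^sup>2 - (z + e) * e" unfolding T_def e_def by (simp add: algebra_simps)
          then show ?thesis using sumT zero_le_power2[of "d i0 - z"] by linarith
        qed
        also have "(z + e) * e \<le> 2 * (s * \<rho>)" using es e0 ez z1 by (intro mult_mono) auto
        finally have "T i \<le> 3 * s * \<rho>" using rs srho by simp
        moreover have "a i * (z - a i) \<le> T i" unfolding T_def by simp
        ultimately show ?thesis by linarith
      qed
    qed
  qed
qed

text \<open>
  The proportion represented by the colour \<open>i\<close> is \<open>d i - a i\<close>. By the previous lemma each \<open>a i\<close> is
  close to \<open>0\<close> or to \<open>z\<close>, and fewer than \<open>b\<close> values close to \<open>z\<close> cannot add up to \<open>b * z\<close>. Hence at
  least \<open>b\<close> of the \<open>s + b\<close> differences are negligible.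
\<close>

lemma few_large_classes:
  fixes s b q :: nat and \<delta> :: real
  assumes b: "b = 1 \<or> b = 2" and q: "q = s + b" and s: "2 \<le> s" and del: "0 < \<delta>"
  obtains \<eta> :: real where "0 < \<eta>" and "\<And>(d :: nat \<Rightarrow> real) (a :: nat \<Rightarrow> real) (z :: real).
    \<lbrakk>\<And>i. i < q \<Longrightarrow> 0 \<le> a i; \<And>i. i < q \<Longrightarrow> a i \<le> d i;
     \<And>i. i < q \<Longrightarrow> 0 < a i \<Longrightarrow> \<exists>j<q. j \<noteq> i \<and> d i \<le> d j;
     (\<Sum>i<q. d i - a i) = 1; (\<Sum>i<q. a i) = b * z; \<bar>1 - s * z\<bar> \<le> \<eta>;
     (\<Sum>i<q. (d i)\<^sup>2 - (a i)\<^sup>2) \<le> 1 / s + \<eta>\<rbrakk>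
    \<Longrightarrow> card {i. i < q \<and> \<delta> < d i - a i} \<le> s"
proof -
  \<comment> \<open>If only \<open>b - 1\<close> of the \<open>a i\<close> were close to \<open>z\<close>, their sum would give \<open>z \<le> \<rho> * M\<close>.\<close>
  define M where "M = 2 * s + 6 * q * s / \<delta>"
  have M: "0 < M" unfolding M_def using s del by (simp add: add_pos_nonneg)
  define \<rho> where "\<rho> = min 1 (min (\<delta> / (4 * s)) (1 / (4 * s * M)))"
  have rho: "0 < \<rho>" "\<rho> \<le> 1" "\<rho> \<le> \<delta> / (4 * s)" "\<rho> \<le> 1 / (4 * s * M)"
    unfolding \<rho>_def using s del M by auto
  have r1: "2 * s * \<rho> \<le> \<delta> / 2" using rho(3) s by (simp add: field_simps)
  have r2: "\<rho> * M < 1 / (2 * s)"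
  proof -
    have "\<rho> * M \<le> 1 / (4 * s)" using rho(4) s M by (simp add: field_simps)
    also have "\<dots> < 1 / (2 * s)" using s by (simp add: field_simps)
    finally show ?thesis .
  qed
  show ?thesis
  proof (rule that[of "min (\<rho> / 2) (\<rho>\<^sup>2 / 2)"])
    show "0 < min (\<rho> / 2) (\<rho>\<^sup>2 / 2)" using rho by simp
    fix d a :: "nat \<Rightarrow> real" and z :: real
    assume a0: "\<And>i. i < q \<Longrightarrow> 0 \<le> a i" and ad: "\<And>i. i < q \<Longrightarrow> a i \<le> d i"
      and twin: "\<And>i. i < q \<Longrightarrow> 0 < a i \<Longrightarrow> \<exists>j<q. j \<noteq> i \<and> d i \<le> d j"
      and total: "(\<Sum>i<q. d i - a i) = 1" and suma: "(\<Sum>i<q. a i) = b * z"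
      and z: "\<bar>1 - s * z\<bar> \<le> min (\<rho> / 2) (\<rho>\<^sup>2 / 2)"
      and sq: "(\<Sum>i<q. (d i)\<^sup>2 - (a i)\<^sup>2) \<le> 1 / s + min (\<rho> / 2) (\<rho>\<^sup>2 / 2)"
    have near: "\<forall>i<q. \<bar>d i - z\<bar> \<le> 2 * s * \<rho> \<and> a i * (z - a i) \<le> 3 * s * \<rho>"
      by (rule near_uniform[OF b q s rho(1,2) a0 ad twin total suma]) (use z sq in auto)
    define T where "T = {i. i < q \<and> z - \<delta> / 2 \<le> a i}"
    have finT: "finite T" "T \<subseteq> {..<q}" unfolding T_def by auto
    have zl: "1 / (2 * s) \<le> z"
    proof -
      have "1 / 2 \<le> s * z" using z rho by linarith
      then show ?thesis using s by (simp add: field_simps)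
    qed
    have "b \<le> card T"
    proof (rule ccontr)
      assume "\<not> b \<le> card T"
      then have cT: "real (card T) \<le> real b - 1" by linarith
      have big: "a i \<le> z + 2 * s * \<rho>" if "i < q" for i
        using near ad[OF that] that by force
      have small: "a i \<le> 6 * s * \<rho> / \<delta>" if i: "i < q" "i \<notin> T" for i
      proof -
        have "a i * (\<delta> / 2) \<le> a i * (z - a i)"
          using i a0[of i] unfolding T_def by (intro mult_left_mono) auto
        also have "\<dots> \<le> 3 * s * \<rho>" using near i by auto
        finally show ?thesis using del by (simp add: field_simps)
      qed
      have zpos: "0 \<le> z + 2 * s * \<rho>" using zl rho s by (smt (verit) divide_nonneg_nonneg mult_nonneg_nonneg of_nat_0_le_iff)
      have "b * z = (\<Sum>i\<in>T. a i) + (\<Sum>i\<in>{..<q} - T. a i)"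
        using suma finT by (simp add: sum.subset_diff add.commute)
      also have "\<dots> \<le> (\<Sum>i\<in>T. z + 2 * s * \<rho>) + (\<Sum>i\<in>{..<q} - T. 6 * s * \<rho> / \<delta>)"
        using big small finT by (intro add_mono sum_mono) auto
      also have "\<dots> \<le> (real b - 1) * (z + 2 * s * \<rho>) + q * (6 * s * \<rho> / \<delta>)"
      proof -
        have "card T * (z + 2 * s * \<rho>) \<le> (real b - 1) * (z + 2 * s * \<rho>)"
          using cT zpos by (intro mult_right_mono) auto
        moreover have "card ({..<q} - T) * (6 * s * \<rho> / \<delta>) \<le> q * (6 * s * \<rho> / \<delta>)"
        proof (intro mult_right_mono)
          have "card ({..<q} - T) \<le> card {..<q}" by (intro card_mono) auto
          then show "real (card ({..<q} - T)) \<le> q" by simp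
        qed (use del rho s in auto)
        ultimately show ?thesis by simp
      qed
      also have "\<dots> \<le> (real b - 1) * z + \<rho> * M"
      proof -
        have "(real b - 1) * (2 * s * \<rho>) \<le> 1 * (2 * s * \<rho>)"
          using b rho by (intro mult_right_mono) auto
        then show ?thesis unfolding M_def by (simp add: algebra_simps)
      qed
      finally have "z \<le> \<rho> * M" by (simp add: algebra_simps)
      then show False using r2 zl by linarith
    qed
    moreover have "{i. i < q \<and> \<delta> < d i - a i} \<subseteq> {..<q} - T"
    proof
      fix i assume "i \<in> {i. i < q \<and> \<delta> < d i - a i}"
      then have i: "i < q" "\<delta> < d i - a i" by auto
      have "d i \<le> z + \<delta> / 2" using near i r1 by force
      then have "\<not> z - \<delta> / 2 \<le> a i" using i by linarith
      then show "i \<in> {..<q} - T" using i by (simp add: T_def)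
    qed
    then have "card {i. i < q \<and> \<delta> < d i - a i} \<le> card ({..<q} - T)"
      by (intro card_mono) auto
    ultimately show "card {i. i < q \<and> \<delta> < d i - a i} \<le> s"
      using finT q by (simp add: card_Diff_subset)
  qed
qed

section \<open>List assignments with few conflicts\<close>

text \<open>
  The \<open>i\<close>-th summand counts the pairs of lists that share the colour \<open>i\<close> and of which at least one is
  represented by \<open>i\<close>. A pair counted for both \<open>i\<close> and \<open>j\<close> would have both colours in both lists,
  so that each of them would come first in the order given by \<open>\<kappa>\<close>.
\<close>

lemma conflicts_ge_class_squares:
  fixes L :: "'a \<Rightarrow> nat set" and \<kappa> :: "nat \<Rightarrow> nat"
  assumes V: "finite V" and inj: "inj_on \<kappa> {..<q}" and L: "\<And>v. v \<in> V \<Longrightarrow> L v \<subseteq> {..<q}"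
    and r: "\<And>v. v \<in> V \<Longrightarrow> r v \<in> L v" "\<And>v i. v \<in> V \<Longrightarrow> i \<in> L v \<Longrightarrow> \<kappa> (r v) \<le> \<kappa> i"
  shows "(\<Sum>i<q. (real (card {v \<in> V. i \<in> L v}))\<^sup>2 - (real (card {v \<in> V. i \<in> L v \<and> r v \<noteq> i}))\<^sup>2)
    \<le> card {(u, v) \<in> V \<times> V. L u \<inter> L v \<noteq> {}}"
proof -
  define D where "D i = {v \<in> V. i \<in> L v}" for i
  define A where "A i = {v \<in> V. i \<in> L v \<and> r v \<noteq> i}" for i
  define P where "P i = D i \<times> D i - A i \<times> A i" for i
  have fin: "finite (D i)" "finite (A i)" "A i \<subseteq> D i" for i
    using V unfolding D_def A_def by auto
  have cP: "real (card (P i)) = (real (card (D i)))\<^sup>2 - (real (card (A i)))\<^sup>2" for i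
  proof -
    have "card (P i) = card (D i \<times> D i) - card (A i \<times> A i)"
      unfolding P_def using fin by (intro card_Diff_subset) auto
    moreover have "card (A i \<times> A i) \<le> card (D i \<times> D i)" using fin by (intro card_mono) auto
    ultimately show ?thesis by (simp add: card_cartesian_product of_nat_diff power2_eq_square)
  qed
  have disj: "P i \<inter> P j = {}" if "i < q" "j < q" "i \<noteq> j" for i j
  proof (rule ccontr)
    assume "P i \<inter> P j \<noteq> {}"
    then obtain u v where uv: "u \<in> V" "v \<in> V" "i \<in> L u" "i \<in> L v" "j \<in> L u" "j \<in> L v"
      "r u = i \<or> r v = i" "r u = j \<or> r v = j"
      unfolding P_def D_def A_def by auto
    then have "\<kappa> i \<le> \<kappa> j" "\<kappa> j \<le> \<kappa> i" using r(2) \<open>i \<noteq> j\<close> by metis+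
    then show False using inj that by (auto dest: inj_onD)
  qed
  have "(\<Sum>i<q. (real (card (D i)))\<^sup>2 - (real (card (A i)))\<^sup>2) = real (\<Sum>i<q. card (P i))"
    using cP by simp
  also have "(\<Sum>i<q. card (P i)) = card (\<Union>i<q. P i)"
    using fin disj by (intro card_UN_disjoint[symmetric]) (auto simp: P_def)
  also have "\<dots> \<le> card {(u, v) \<in> V \<times> V. L u \<inter> L v \<noteq> {}}"
    using V by (intro card_mono) (auto simp: P_def D_def intro: finite_subset[of _ "V \<times> V"])
  finally show ?thesis unfolding D_def A_def by simp
qed

text \<open>
  Passing to smaller lists creates no new conflicts, so the total excess, so far bounded only from
  below, may be lowered to a prescribed value. This is needed because the stability argument requires
  \<open>z\<close> to be close to \<open>1 / s\<close> from both sides.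
\<close>

lemma shrink_lists:
  assumes V: "finite V" and L: "\<And>v. v \<in> V \<Longrightarrow> finite (L v) \<and> L v \<noteq> {}"
    and t: "t \<le> (\<Sum>v\<in>V. card (L v) - 1)"
  shows "\<exists>L'. (\<forall>v\<in>V. L' v \<subseteq> L v \<and> L' v \<noteq> {}) \<and> (\<Sum>v\<in>V. card (L' v) - 1) = t"
  using t
proof (induction t)
  case 0
  show ?case
    using L by (intro exI[of _ "\<lambda>v. {SOME i. i \<in> L v}"]) (auto simp: some_in_eq)
next
  case (Suc t)
  then obtain L' where L': "\<forall>v\<in>V. L' v \<subseteq> L v \<and> L' v \<noteq> {}" "(\<Sum>v\<in>V. card (L' v) - 1) = t"
    by auto
  have "\<exists>v\<in>V. L' v \<noteq> L v"
  proof (rule ccontr)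
    assume "\<not> (\<exists>v\<in>V. L' v \<noteq> L v)"
    then have "(\<Sum>v\<in>V. card (L' v) - 1) = (\<Sum>v\<in>V. card (L v) - 1)" by (intro sum.cong) auto
    then show False using L'(2) Suc.prems by linarith
  qed
  then obtain v i where vi: "v \<in> V" "i \<in> L v" "i \<notin> L' v" using L' by blast
  define L'' where "L'' = L'(v := insert i (L' v))"
  have fin: "finite (L' v)" using L' L vi finite_subset by metis
  then have "card (L' v) \<noteq> 0" using L' vi by auto
  moreover have "card (L'' v) = Suc (card (L' v))" using fin vi by (simp add: L''_def)
  ultimately have "card (L'' v) - 1 = Suc (card (L' v) - 1)" by linarith
  moreover have "(\<Sum>w\<in>V - {v}. card (L'' w) - 1) = (\<Sum>w\<in>V - {v}. card (L' w) - 1)"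
    by (intro sum.cong) (auto simp: L''_def)
  ultimately have "(\<Sum>w\<in>V. card (L'' w) - 1) = Suc (\<Sum>w\<in>V. card (L' w) - 1)"
    using V vi by (simp add: sum.remove)
  then show ?case
    using L' vi by (intro exI[of _ L'']) (auto simp: L''_def)
qed

text \<open>
  The combinatorial form of the bound on the number of large classes: the vertices represented by one
  of the at most \<open>s\<close> frequent colours are grouped by that colour, so two of them in the same group
  conflict, and only few vertices remain.
\<close>

lemma list_stability_aux:
  fixes s b q :: nat and \<delta> :: real
  assumes b: "b = 1 \<or> b = 2" and q: "q = s + b" and s: "2 \<le> s" and del: "0 < \<delta>"
  obtains \<eta> :: real where "0 < \<eta>" and "\<And>(V :: 'a set) L n.
    \<lbrakk>finite V; card V = n; 0 < n; \<And>v. v \<in> V \<Longrightarrow> L v \<subseteq> {..<q} \<and> L v \<noteq> {};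
     real (card {(u, v) \<in> V \<times> V. L u \<inter> L v \<noteq> {}}) \<le> (1 / s + \<eta>) * (real n)\<^sup>2;
     \<bar>real (\<Sum>v\<in>V. card (L v) - 1) - b * real n / s\<bar> \<le> \<eta> * n\<rbrakk>
    \<Longrightarrow> \<exists>f. (\<forall>v\<in>V. f v < s) \<and>
        real (card {(u, v) \<in> V \<times> V. f u = f v \<and> L u \<inter> L v = {}}) \<le> \<delta> * (real n)\<^sup>2"
proof -
  have q0: "0 < q" using q s by simp
  obtain \<eta> :: real where eta: "0 < \<eta>" and classes: "\<And>(d :: nat \<Rightarrow> real) (a :: nat \<Rightarrow> real) (z :: real).
    \<lbrakk>\<And>i. i < q \<Longrightarrow> 0 \<le> a i; \<And>i. i < q \<Longrightarrow> a i \<le> d i;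
     \<And>i. i < q \<Longrightarrow> 0 < a i \<Longrightarrow> \<exists>j<q. j \<noteq> i \<and> d i \<le> d j;
     (\<Sum>i<q. d i - a i) = 1; (\<Sum>i<q. a i) = b * z; \<bar>1 - s * z\<bar> \<le> \<eta>;
     (\<Sum>i<q. (d i)\<^sup>2 - (a i)\<^sup>2) \<le> 1 / s + \<eta>\<rbrakk>
    \<Longrightarrow> card {i. i < q \<and> \<delta> / (2 * q) < d i - a i} \<le> s"
    by (rule few_large_classes[OF b q s, of "\<delta> / (2 * q)"]) (use del q0 in auto)
  show ?thesis
  proof (rule that[of "\<eta> / s"])
    show "0 < \<eta> / s" using eta s by simp
    fix V :: "'a set" and L :: "'a \<Rightarrow> nat set" and n :: nat
    assume V: "finite V" "card V = n" and n: "0 < n"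
      and L: "\<And>v. v \<in> V \<Longrightarrow> L v \<subseteq> {..<q} \<and> L v \<noteq> {}"
      and conf: "real (card {(u, v) \<in> V \<times> V. L u \<inter> L v \<noteq> {}}) \<le> (1 / s + \<eta> / s) * (real n)\<^sup>2"
      and y: "\<bar>real (\<Sum>v\<in>V. card (L v) - 1) - b * real n / s\<bar> \<le> \<eta> / s * n"
    define D where "D i = card {v \<in> V. i \<in> L v}" for i
    \<comment> \<open>The key \<open>\<kappa>\<close> orders the colours by decreasing frequency and breaks ties by the colour itself.\<close>
    define \<kappa> where "\<kappa> i = (n - D i) * q + i" for i
    define r where "r v = arg_min_on \<kappa> (L v)" for v
    define A where "A i = card {v \<in> V. i \<in> L v \<and> r v \<noteq> i}" for i
    have finL: "finite (L v)" if "v \<in> V" for v using L[OF that] finite_subset by auto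
    have r: "r v \<in> L v" "\<And>i. i \<in> L v \<Longrightarrow> \<kappa> (r v) \<le> \<kappa> i" if "v \<in> V" for v
      unfolding r_def using finL[OF that] L[OF that]
      by (auto intro: arg_min_if_finite(1) arg_min_least)
    have rq: "r v < q" if "v \<in> V" for v using r(1)[OF that] L[OF that] by auto
    have Dn: "D i \<le> n" for i unfolding D_def V(2)[symmetric] using V by (intro card_mono) auto
    have inj: "inj_on \<kappa> {..<q}"
    proof (rule inj_onI)
      fix i j assume "i \<in> {..<q}" "j \<in> {..<q}" "\<kappa> i = \<kappa> j"
      then have "\<kappa> i mod q = \<kappa> j mod q" "i < q" "j < q" by auto
      then show "i = j" by (simp add: \<kappa>_def)
    qed
    have order: "D i \<le> D j" if "i < q" "j < q" "\<kappa> j \<le> \<kappa> i" for i j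
    proof -
      have "\<kappa> j div q \<le> \<kappa> i div q" using that by (intro div_le_mono)
      then have "n - D j \<le> n - D i" using that by (simp add: \<kappa>_def)
      then show ?thesis using Dn[of i] Dn[of j] by linarith
    qed
    define cls where "cls i = card {v \<in> V. r v = i}" for i
    have DA: "D i = A i + cls i" for i
    proof -
      have "{v \<in> V. i \<in> L v} = {v \<in> V. i \<in> L v \<and> r v \<noteq> i} \<union> {v \<in> V. r v = i}"
        using r(1) by auto
      then show ?thesis unfolding D_def A_def cls_def using V
        by (subst card_Un_disjoint[symmetric]) auto
    qed
    have sumcls: "(\<Sum>i<q. cls i) = n"
    proof -
      have "(\<Union>i<q. {v \<in> V. r v = i}) = V" using rq by auto
      then have "n = card (\<Union>i<q. {v \<in> V. r v = i})" using V by simp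
      also have "\<dots> = (\<Sum>i<q. cls i)" unfolding cls_def
        using V by (intro card_UN_disjoint) auto
      finally show ?thesis by simp
    qed
    have sumD: "(\<Sum>i<q. D i) = (\<Sum>v\<in>V. card (L v))"
    proof -
      have "(\<Sum>i<q. D i) = (\<Sum>i<q. \<Sum>v\<in>V. if i \<in> L v then 1 else 0)"
        unfolding D_def using V by (simp add: sum.If_cases Int_def)
      also have "\<dots> = (\<Sum>v\<in>V. \<Sum>i<q. if i \<in> L v then 1 else 0)" by (rule sum.swap)
      also have "\<dots> = (\<Sum>v\<in>V. card (L v))"
      proof (intro sum.cong refl)
        fix v assume "v \<in> V"
        then have "{..<q} \<inter> L v = L v" using L by auto
        then show "(\<Sum>i<q. if i \<in> L v then 1 else 0) = card (L v)" by (simp add: sum.If_cases Int_def)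
      qed
      finally show ?thesis .
    qed
    have sumA: "(\<Sum>i<q. A i) = (\<Sum>v\<in>V. card (L v) - 1)"
    proof -
      have "(\<Sum>v\<in>V. card (L v)) = (\<Sum>v\<in>V. (card (L v) - 1) + 1)"
      proof (intro sum.cong refl)
        fix v assume "v \<in> V"
        then have "card (L v) \<noteq> 0" using finL L by auto
        then show "card (L v) = (card (L v) - 1) + 1" by simp
      qed
      also have "\<dots> = (\<Sum>v\<in>V. card (L v) - 1) + n" using V by (simp only: sum.distrib) simp
      finally have "(\<Sum>i<q. A i + cls i) = (\<Sum>v\<in>V. card (L v) - 1) + n" using sumD DA by simp
      then show ?thesis using sumcls by (simp add: sum.distrib)
    qed
    define d where "d i = real (D i) / n" for i
    define a where "a i = real (A i) / n" for i
    define z where "z = real (\<Sum>v\<in>V. card (L v) - 1) / (b * n)"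
    define R where "R = {i. i < q \<and> \<delta> / (2 * q) < d i - a i}"
    have b0: "0 < b" using b by auto
    have "card R \<le> s" unfolding R_def
    proof (rule classes)
      show "0 \<le> a i" "a i \<le> d i" if "i < q" for i
        using n DA[of i] unfolding a_def d_def by (auto intro: divide_right_mono)
      show "\<exists>j<q. j \<noteq> i \<and> d i \<le> d j" if i: "i < q" "0 < a i" for i
      proof -
        have "0 < A i" using i(2) n by (simp add: a_def zero_less_divide_iff)
        then have "{v \<in> V. i \<in> L v \<and> r v \<noteq> i} \<noteq> {}" unfolding A_def by force
        then obtain v where v: "v \<in> V" "i \<in> L v" "r v \<noteq> i" by auto
        have "D i \<le> D (r v)" by (rule order[OF i(1) rq[OF v(1)] r(2)[OF v(1,2)]])
        then have "d i \<le> d (r v)" unfolding d_def by (intro divide_right_mono) auto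
        then show ?thesis using v(3) rq[OF v(1)] by blast
      qed
      have "(\<Sum>i<q. d i - a i) = (\<Sum>i<q. real (cls i) / n)"
        unfolding d_def a_def DA by (simp add: add_divide_distrib)
      also have "\<dots> = real (\<Sum>i<q. cls i) / n" by (simp add: sum_divide_distrib)
      finally show "(\<Sum>i<q. d i - a i) = 1" using sumcls n by simp
      have "(\<Sum>i<q. a i) = real (\<Sum>i<q. A i) / n" unfolding a_def by (simp add: sum_divide_distrib)
      then show "(\<Sum>i<q. a i) = b * z" using sumA b0 by (simp add: z_def)
      show "\<bar>1 - s * z\<bar> \<le> \<eta>"
      proof -
        define Y where "Y = real (\<Sum>v\<in>V. card (L v) - 1)"
        have "(Y - b * real n / s) * (s / (b * n)) = s * (Y / (b * n)) - (b * real n / s) * (s / (b * n))"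
          by (simp only: left_diff_distrib) (simp only: times_divide_eq_left times_divide_eq_right mult.commute)
        also have "(b * real n / s) * (s / (b * n)) = 1" using b0 n s by simp
        finally have "1 - s * z = - ((Y - b * real n / s) * (s / (b * n)))"
          unfolding z_def Y_def[symmetric] by linarith
        then have "\<bar>1 - s * z\<bar> = \<bar>Y - b * real n / s\<bar> * (s / (b * n))"
          by (simp add: abs_mult)
        also have "\<dots> \<le> (\<eta> / s * n) * (s / (b * n))"
          using y unfolding Y_def[symmetric] by (intro mult_right_mono) auto
        also have "\<dots> = \<eta> / b" using s n b0 by (simp add: field_simps)
        also have "\<dots> \<le> \<eta>" using eta b0 by (simp add: field_simps)
        finally show ?thesis .
      qed
      have "(\<Sum>i<q. (d i)\<^sup>2 - (a i)\<^sup>2) = (\<Sum>i<q. (real (D i))\<^sup>2 - (real (A i))\<^sup>2) / (real n)\<^sup>2"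
        unfolding d_def a_def sum_divide_distrib by (simp add: power_divide diff_divide_distrib)
      also have "\<dots> \<le> ((1 / s + \<eta> / s) * (real n)\<^sup>2) / (real n)\<^sup>2"
      proof (intro divide_right_mono order.trans[OF _ conf])
        show "(\<Sum>i<q. (real (D i))\<^sup>2 - (real (A i))\<^sup>2) \<le> real (card {(u, v) \<in> V \<times> V. L u \<inter> L v \<noteq> {}})"
          unfolding D_def A_def
          by (rule conflicts_ge_class_squares[OF V(1) inj]) (use L r in auto)
      qed auto
      also have "\<dots> = 1 / s + \<eta> / s" using n by simp
      also have "\<dots> \<le> 1 / s + \<eta>" using eta s by (simp add: field_simps)
      finally show "(\<Sum>i<q. (d i)\<^sup>2 - (a i)\<^sup>2) \<le> 1 / s + \<eta>" .
    qed
    then have "\<exists>h. h ` R \<subseteq> {..<s} \<and> inj_on h R"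
      using card_le_inj[of R "{..<s}"] by (auto simp: R_def)
    then obtain h where h: "h ` R \<subseteq> {..<s}" "inj_on h R" by blast
    define f where "f v = (if r v \<in> R then h (r v) else 0)" for v
    define X where "X = {v \<in> V. r v \<notin> R}"
    have cX: "real (card X) \<le> \<delta> / 2 * n"
    proof -
      have "X \<subseteq> (\<Union>i\<in>{..<q} - R. {v \<in> V. r v = i})" unfolding X_def using rq by auto
      then have "card X \<le> card (\<Union>i\<in>{..<q} - R. {v \<in> V. r v = i})"
        using V by (intro card_mono) auto
      also have "\<dots> \<le> (\<Sum>i\<in>{..<q} - R. cls i)" unfolding cls_def by (intro card_UN_le) auto
      finally have "real (card X) \<le> (\<Sum>i\<in>{..<q} - R. real (cls i))" by (metis of_nat_le_iff of_nat_sum)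
      also have "\<dots> \<le> (\<Sum>i\<in>{..<q} - R. \<delta> / (2 * q) * n)"
      proof (intro sum_mono)
        fix i assume "i \<in> {..<q} - R"
        then have "d i - a i \<le> \<delta> / (2 * q)" unfolding R_def by auto
        moreover have "d i - a i = cls i / n" unfolding d_def a_def DA by (simp add: add_divide_distrib)
        ultimately show "real (cls i) \<le> \<delta> / (2 * q) * n" using n by (simp add: field_simps)
      qed
      also have "\<dots> \<le> (\<Sum>i<q. \<delta> / (2 * q) * n)"
        using del by (intro sum_mono2) auto
      also have "\<dots> = \<delta> / 2 * n" using q0 by simp
      finally show ?thesis .
    qed
    show "\<exists>f. (\<forall>v\<in>V. f v < s) \<and>
        real (card {(u, v) \<in> V \<times> V. f u = f v \<and> L u \<inter> L v = {}}) \<le> \<delta> * (real n)\<^sup>2"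
    proof (intro exI[of _ f] conjI ballI)
      show "f v < s" if "v \<in> V" for v using h s unfolding f_def by auto
      have "{(u, v) \<in> V \<times> V. f u = f v \<and> L u \<inter> L v = {}} \<subseteq> X \<times> V \<union> V \<times> X"
      proof
        fix p assume "p \<in> {(u, v) \<in> V \<times> V. f u = f v \<and> L u \<inter> L v = {}}"
        then obtain u v where p: "p = (u, v)" and uv: "u \<in> V" "v \<in> V" "f u = f v" "L u \<inter> L v = {}"
          by auto
        show "p \<in> X \<times> V \<union> V \<times> X"
        proof (rule ccontr)
          assume "p \<notin> X \<times> V \<union> V \<times> X"
          then have "r u \<in> R" "r v \<in> R" using uv p unfolding X_def by auto
          then have "r u = r v" using uv h unfolding f_def by (auto dest: inj_onD)
          then show False using r(1)[OF uv(1)] r(1)[OF uv(2)] uv(4) by auto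
        qed
      qed
      then have "card {(u, v) \<in> V \<times> V. f u = f v \<and> L u \<inter> L v = {}} \<le> card (X \<times> V \<union> V \<times> X)"
        using V by (intro card_mono) (auto simp: X_def)
      also have "\<dots> \<le> card (X \<times> V) + card (V \<times> X)" by (rule card_Un_le)
      finally have "card {(u, v) \<in> V \<times> V. f u = f v \<and> L u \<inter> L v = {}} \<le> 2 * (card X * n)"
        using V by (simp add: card_cartesian_product mult.commute)
      then have "real (card {(u, v) \<in> V \<times> V. f u = f v \<and> L u \<inter> L v = {}}) \<le> real (2 * (card X * n))"
        by (simp only: of_nat_le_iff)
      also have "\<dots> = 2 * (real (card X) * n)" by simp
      also have "\<dots> \<le> 2 * (\<delta> / 2 * n * n)" using cX by (intro mult_left_mono mult_right_mono) auto
      finally show "real (card {(u, v) \<in> V \<times> V. f u = f v \<and> L u \<inter> L v = {}}) \<le> \<delta> * (real n)\<^sup>2"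
        by (simp add: power2_eq_square)
    qed
  qed
qed

text \<open>
  The upper bound on the excess is obtained by shrinking the lists. For \<open>b = 0\<close> there is nothing to
  prove beyond grouping the vertices by any colour of their lists.
\<close>

lemma list_stability:
  fixes s b q :: nat and \<delta> :: real
  assumes b: "b \<le> 2" and q: "q = s + b" and s: "2 \<le> s" and del: "0 < \<delta>"
  obtains \<eta> :: real where "0 < \<eta>" and "\<And>(V :: 'a set) L n.
    \<lbrakk>finite V; card V = n; 1 \<le> \<eta> * n; \<And>v. v \<in> V \<Longrightarrow> L v \<subseteq> {..<q} \<and> L v \<noteq> {};
     real (card {(u, v) \<in> V \<times> V. L u \<inter> L v \<noteq> {}}) \<le> (1 / s + \<eta>) * (real n)\<^sup>2;
     b * real n / s - \<eta> * n \<le> real (\<Sum>v\<in>V. card (L v) - 1)\<rbrakk>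
    \<Longrightarrow> \<exists>f. (\<forall>v\<in>V. f v < s) \<and>
        real (card {(u, v) \<in> V \<times> V. f u = f v \<and> L u \<inter> L v = {}}) \<le> \<delta> * (real n)\<^sup>2"
proof (cases "b = 0")
  case True
  show ?thesis
  proof (rule that[of 1])
    fix V :: "'a set" and L :: "'a \<Rightarrow> nat set" and n :: nat
    assume L: "\<And>v. v \<in> V \<Longrightarrow> L v \<subseteq> {..<q} \<and> L v \<noteq> {}"
    define f where "f v = (SOME i. i \<in> L v)" for v
    have f: "f v \<in> L v" if "v \<in> V" for v using L[OF that] by (simp add: f_def some_in_eq)
    then have "{(u, v) \<in> V \<times> V. f u = f v \<and> L u \<inter> L v = {}} = {}" by force
    then have "real (card {(u, v) \<in> V \<times> V. f u = f v \<and> L u \<inter> L v = {}}) \<le> \<delta> * (real n)\<^sup>2"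
      using del by (simp only: card.empty) simp
    moreover have "\<forall>v\<in>V. f v < s" using f L q True by fastforce
    ultimately show "\<exists>f. (\<forall>v\<in>V. f v < s) \<and>
        real (card {(u, v) \<in> V \<times> V. f u = f v \<and> L u \<inter> L v = {}}) \<le> \<delta> * (real n)\<^sup>2"
      by blast
  qed simp
next
  case False
  then have b12: "b = 1 \<or> b = 2" using b by linarith
  show ?thesis
  proof (rule list_stability_aux[OF b12 q s del, where ?'a = 'a])
    fix \<eta> :: real
    assume eta: "0 < \<eta>" and *: "\<And>(V :: 'a set) L n.
    \<lbrakk>finite V; card V = n; 0 < n; \<And>v. v \<in> V \<Longrightarrow> L v \<subseteq> {..<q} \<and> L v \<noteq> {};
     real (card {(u, v) \<in> V \<times> V. L u \<inter> L v \<noteq> {}}) \<le> (1 / s + \<eta>) * (real n)\<^sup>2;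
     \<bar>real (\<Sum>v\<in>V. card (L v) - 1) - b * real n / s\<bar> \<le> \<eta> * n\<rbrakk>
    \<Longrightarrow> \<exists>f. (\<forall>v\<in>V. f v < s) \<and>
        real (card {(u, v) \<in> V \<times> V. f u = f v \<and> L u \<inter> L v = {}}) \<le> \<delta> * (real n)\<^sup>2"
    show ?thesis
    proof (rule that[OF eta])
    fix V :: "'a set" and L :: "'a \<Rightarrow> nat set" and n :: nat
    assume V: "finite V" "card V = n" and n: "1 \<le> \<eta> * n"
      and L: "\<And>v. v \<in> V \<Longrightarrow> L v \<subseteq> {..<q} \<and> L v \<noteq> {}"
      and conf: "real (card {(u, v) \<in> V \<times> V. L u \<inter> L v \<noteq> {}}) \<le> (1 / s + \<eta>) * (real n)\<^sup>2"
      and y: "b * real n / s - \<eta> * n \<le> real (\<Sum>v\<in>V. card (L v) - 1)"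
    have n0: "0 < n" using n by (cases n) auto
    \<comment> \<open>The shrunk lists have excess \<open>b * n / s\<close> up to rounding, or the original one if that is less.\<close>
    define t where "t = min (\<Sum>v\<in>V. card (L v) - 1) (b * n div s)"
    have tle: "real t \<le> b * real n / s"
    proof -
      have "real t \<le> real (b * n div s)" unfolding t_def by simp
      also have "\<dots> \<le> real (b * n) / s" by (rule of_nat_div_le_of_nat)
      finally show ?thesis by simp
    qed
    have tge: "b * real n / s - \<eta> * n \<le> real t"
    proof (cases "(\<Sum>v\<in>V. card (L v) - 1) \<le> b * n div s")
      case True
      then show ?thesis using y by (simp add: t_def)
    next
      case False
      then have "t = b * n div s" by (simp add: t_def)
      moreover have "b * n < (b * n div s + 1) * s" using s
        by (metis Suc_eq_plus1 dividend_less_div_times le_0_eq mult.commute mult_Suc_right neq0_conv numeral_2_eq_2 plus_1_eq_Suc add.commute zero_less_Suc not_less_eq_eq)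
      then have "real (b * n) < real ((b * n div s + 1) * s)" by (simp only: of_nat_less_iff)
      then have "b * real n / s < real (b * n div s) + 1" using s by (simp add: field_simps)
      ultimately show ?thesis using n by simp
    qed
    obtain L' where L': "\<forall>v\<in>V. L' v \<subseteq> L v \<and> L' v \<noteq> {}" "(\<Sum>v\<in>V. card (L' v) - 1) = t"
      using shrink_lists[OF V(1), of L t] L finite_subset[of "L _" "{..<q}"] by (auto simp: t_def)
    have mono: "L' u \<inter> L' v \<subseteq> L u \<inter> L v" if "u \<in> V" "v \<in> V" for u v
      using L'(1) that by blast
    have fin: "finite {(u, v) \<in> V \<times> V. P u v}" for P
      using V by (auto intro: finite_subset[of _ "V \<times> V"])
    have "\<exists>f. (\<forall>v\<in>V. f v < s) \<and>
        real (card {(u, v) \<in> V \<times> V. f u = f v \<and> L' u \<inter> L' v = {}}) \<le> \<delta> * (real n)\<^sup>2"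
    proof (rule *[OF V n0])
      show "L' v \<subseteq> {..<q} \<and> L' v \<noteq> {}" if "v \<in> V" for v using L L' that by blast
      have "card {(u, v) \<in> V \<times> V. L' u \<inter> L' v \<noteq> {}} \<le> card {(u, v) \<in> V \<times> V. L u \<inter> L v \<noteq> {}}"
        by (intro card_mono fin) (use mono in \<open>fastforce\<close>)
      then show "real (card {(u, v) \<in> V \<times> V. L' u \<inter> L' v \<noteq> {}}) \<le> (1 / s + \<eta>) * (real n)\<^sup>2"
        using conf by linarith
      show "\<bar>real (\<Sum>v\<in>V. card (L' v) - 1) - b * real n / s\<bar> \<le> \<eta> * n"
      proof -
        have "0 \<le> \<eta> * n" using eta by simp
        then show ?thesis unfolding L'(2) abs_le_iff using tle tge by linarith
      qed
    qed
    then obtain f where f: "\<forall>v\<in>V. f v < s"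
      "real (card {(u, v) \<in> V \<times> V. f u = f v \<and> L' u \<inter> L' v = {}}) \<le> \<delta> * (real n)\<^sup>2" by blast
    have "card {(u, v) \<in> V \<times> V. f u = f v \<and> L u \<inter> L v = {}}
        \<le> card {(u, v) \<in> V \<times> V. f u = f v \<and> L' u \<inter> L' v = {}}"
      by (intro card_mono fin) (use mono in \<open>fastforce\<close>)
    then have "real (card {(u, v) \<in> V \<times> V. f u = f v \<and> L u \<inter> L v = {}}) \<le> \<delta> * (real n)\<^sup>2"
      using f(2) by linarith
    then show "\<exists>f. (\<forall>v\<in>V. f v < s) \<and>
        real (card {(u, v) \<in> V \<times> V. f u = f v \<and> L u \<inter> L v = {}}) \<le> \<delta> * (real n)\<^sup>2"
      using f(1) by blast
    qed
  qed
qed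

section \<open>Graphs and numbers of colourings\<close>

text \<open>
  Counting ordered pairs of adjacent vertices makes edge counts comparable with subsets of
  \<open>V \<times> V\<close>, such as the set of conflicting pairs.
\<close>

definition arcs :: "'a ugraph \<Rightarrow> ('a \<times> 'a) set" where
  "arcs G = {(u, v). {u, v} \<in> edges G}"

lemma simple_graph_finite:
  assumes "simple_graph G"
  shows "finite (verts G)" "finite (edges G)"
proof -
  show "finite (verts G)" using assms by (simp add: simple_graph_def)
  moreover have "edges G \<subseteq> Pow (verts G)" using assms by (auto simp: simple_graph_def)
  ultimately show "finite (edges G)" using finite_subset by auto
qed

lemma simple_graph_edge:
  assumes "simple_graph G" "{u, v} \<in> edges G"
  shows "u \<in> verts G" "v \<in> verts G" "u \<noteq> v"
  using assms by (auto simp: simple_graph_def card_2_iff doubleton_eq_iff)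

lemma simple_graph_remove_edges:
  "simple_graph H \<Longrightarrow> F \<subseteq> edges H \<Longrightarrow> simple_graph \<lparr>verts = verts H, edges = F\<rparr>"
  by (auto simp: simple_graph_def)

lemma arcs_subset: "simple_graph G \<Longrightarrow> arcs G \<subseteq> verts G \<times> verts G"
  using simple_graph_edge by (fastforce simp: arcs_def)

lemma card_arcs:
  assumes "simple_graph G"
  shows "card (arcs G) = 2 * card (edges G)"
proof -
  have two: "card {(u, v). {u, v} = e} = 2 \<and> finite {(u, v). {u, v} = e}" if "e \<in> edges G" for e
  proof -
    obtain x y where "e = {x, y}" "x \<noteq> y"
      using assms \<open>e \<in> edges G\<close> by (auto simp: simple_graph_def card_2_iff)
    then have "{(u, v). {u, v} = e} = {(x, y), (y, x)}" by (auto simp: doubleton_eq_iff)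
    then show ?thesis using \<open>x \<noteq> y\<close> by simp
  qed
  have "arcs G = (\<Union>e\<in>edges G. {(u, v). {u, v} = e})" unfolding arcs_def by auto
  also have "card \<dots> = (\<Sum>e\<in>edges G. card {(u, v). {u, v} = e})"
    using two simple_graph_finite[OF assms] by (intro card_UN_disjoint) auto
  also have "\<dots> = 2 * card (edges G)" using two by simp
  finally show ?thesis .
qed

lemma finite_proper_colorings:
  assumes "finite (verts G)"
  shows "finite (proper_colorings q G)"
proof (rule finite_subset)
  show "proper_colorings q G \<subseteq> verts G \<rightarrow>\<^sub>E {..<q}" by (auto simp: proper_colorings_def)
  show "finite (verts G \<rightarrow>\<^sub>E {..<q})" using assms by (intro finite_PiE) auto
qed

lemma num_colorings_iso_le:
  assumes G: "simple_graph G" and H: "simple_graph H" and iso: "graph_iso G H"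
  shows "num_colorings G q \<le> num_colorings H q"
proof -
  obtain f where f: "bij_betw f (verts G) (verts H)" "(\<lambda>e. f ` e) ` edges G = edges H"
    using iso unfolding graph_iso_def by blast
  define g where "g = inv_into (verts G) f"
  have gf: "g (f v) = v" if "v \<in> verts G" for v
    using f that unfolding g_def by (auto simp: bij_betw_def)
  have gV: "g w \<in> verts G" "f (g w) = w" if "w \<in> verts H" for w
    using f that unfolding g_def by (auto simp: bij_betw_def inv_into_into f_inv_into_f)
  define \<phi> where "\<phi> c = restrict (\<lambda>w. c (g w)) (verts H)" for c :: "'a \<Rightarrow> nat"
  have "inj_on \<phi> (proper_colorings q G)"
  proof (rule inj_onI)
    fix c c' assume c: "c \<in> proper_colorings q G" "c' \<in> proper_colorings q G" "\<phi> c = \<phi> c'"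
    show "c = c'"
    proof
      fix v
      show "c v = c' v"
      proof (cases "v \<in> verts G")
        case True
        then have "f v \<in> verts H" using f by (auto simp: bij_betw_def)
        then show ?thesis using fun_cong[OF c(3), of "f v"] gf True by (simp add: \<phi>_def)
      next
        case False
        then show ?thesis using c by (auto simp: proper_colorings_def PiE_def extensional_def)
      qed
    qed
  qed
  moreover have "\<phi> ` proper_colorings q G \<subseteq> proper_colorings q H"
  proof (rule image_subsetI)
    fix c assume c: "c \<in> proper_colorings q G"
    have "\<phi> c u \<noteq> \<phi> c v" if e: "{u, v} \<in> edges H" for u v
    proof -
      obtain e' where e': "e' \<in> edges G" "f ` e' = {u, v}" using e f(2) by (metis (no_types, lifting) imageE)
      have uv: "u \<in> verts H" "v \<in> verts H" using simple_graph_edge[OF H e] by auto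
      have "e' \<subseteq> verts G" using G e' by (auto simp: simple_graph_def)
      then have "e' = g ` f ` e'" using gf by force
      then have "{g u, g v} \<in> edges G" using e' by simp
      then show ?thesis using c uv by (auto simp: proper_colorings_def \<phi>_def)
    qed
    moreover have "\<phi> c \<in> verts H \<rightarrow>\<^sub>E {..<q}"
      using c gV by (auto simp: \<phi>_def proper_colorings_def)
    ultimately show "\<phi> c \<in> proper_colorings q H" by (simp add: proper_colorings_def)
  qed
  ultimately show ?thesis unfolding num_colorings_def
    by (intro card_inj_on_le[of \<phi>] finite_proper_colorings simple_graph_finite[OF H])
qed

lemma prod_lists_le_num_colorings:
  assumes G: "simple_graph G"
    and L: "\<And>v. v \<in> verts G \<Longrightarrow> L v \<subseteq> {..<q}"
    and disj: "\<And>u v. {u, v} \<in> edges G \<Longrightarrow> L u \<inter> L v = {}"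
  shows "(\<Prod>v\<in>verts G. card (L v)) \<le> num_colorings G q"
proof -
  have "Pi\<^sub>E (verts G) L \<subseteq> proper_colorings q G"
  proof
    fix c assume c: "c \<in> Pi\<^sub>E (verts G) L"
    then have "c \<in> verts G \<rightarrow>\<^sub>E {..<q}" using L by (auto simp: PiE_iff)
    moreover have "c u \<noteq> c v" if "{u, v} \<in> edges G" for u v
      using c disj[OF that] simple_graph_edge[OF G that] by (auto simp: PiE_iff)
    ultimately show "c \<in> proper_colorings q G" by (auto simp: proper_colorings_def)
  qed
  then have "card (Pi\<^sub>E (verts G) L) \<le> num_colorings G q"
    unfolding num_colorings_def
    by (intro card_mono finite_proper_colorings simple_graph_finite[OF G])
  then show ?thesis using simple_graph_finite[OF G] by (simp add: card_PiE)
qed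

text \<open>
  If every colouring is drawn from one of finitely many list assignments, the best of these accounts
  for the number of colourings up to the number of assignments. Both upper bounds on numbers of
  colourings below have this form.
\<close>

lemma num_colorings_le_best_lists:
  assumes V: "finite (verts G)" and I: "finite I" and pos: "0 < num_colorings G q"
    and L: "\<And>i v. finite (L i v)"
    and cover: "\<And>c. c \<in> proper_colorings q G \<Longrightarrow> \<exists>i\<in>I. c \<in> Pi\<^sub>E (verts G) (L i)"
  shows "\<exists>i\<in>I. num_colorings G q \<le> card I * (\<Prod>v\<in>verts G. card (L i v))"
proof -
  define g where "g i = (\<Prod>v\<in>verts G. card (L i v))" for i
  have "proper_colorings q G \<subseteq> (\<Union>i\<in>I. Pi\<^sub>E (verts G) (L i))" using cover by auto
  then have "num_colorings G q \<le> card (\<Union>i\<in>I. Pi\<^sub>E (verts G) (L i))"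
    unfolding num_colorings_def using V I L by (intro card_mono finite_UN_I finite_PiE) auto
  also have "\<dots> \<le> (\<Sum>i\<in>I. card (Pi\<^sub>E (verts G) (L i)))" using I by (rule card_UN_le)
  also have "\<dots> = (\<Sum>i\<in>I. g i)" using V by (simp add: card_PiE g_def)
  finally have le: "num_colorings G q \<le> (\<Sum>i\<in>I. g i)" .
  then have "I \<noteq> {}" using pos by auto
  then have "Max (g ` I) \<in> g ` I" using I by (intro Max_in) auto
  then obtain i where i: "i \<in> I" "g i = Max (g ` I)" by auto
  then have "(\<Sum>i\<in>I. g i) \<le> of_nat (card I) * g i"
    using I by (intro sum_bounded_above) auto
  then have "num_colorings G q \<le> card I * g i" using le by simp
  then show ?thesis using i(1) unfolding g_def by blast
qed

lemma prod_card_le_power_two: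
  assumes "\<And>v. v \<in> V \<Longrightarrow> 0 < card (L v)"
  shows "(\<Prod>v\<in>V. card (L v)) \<le> 2 ^ (\<Sum>v\<in>V. card (L v) - 1)"
proof -
  have "card (L v) \<le> 2 ^ (card (L v) - 1)" if "v \<in> V" for v
    using assms[OF that] by (cases "card (L v)") (auto intro: Suc_leI less_exp)
  then show ?thesis unfolding power_sum by (intro prod_mono) auto
qed

lemma prod_ge_power_two:
  assumes V: "finite V" and D: "D \<subseteq> V" and "\<And>v. v \<in> D \<Longrightarrow> 2 \<le> a v" "\<And>v. v \<in> V \<Longrightarrow> (1::nat) \<le> a v"
  shows "2 ^ card D \<le> (\<Prod>v\<in>V. a v)"
proof -
  have "(2::nat) ^ card D = (\<Prod>v\<in>V. if v \<in> D then 2 else 1)"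
    using V D by (simp add: prod.If_cases Int_absorb1)
  also have "\<dots> \<le> (\<Prod>v\<in>V. a v)" using assms by (intro prod_mono) auto
  finally show ?thesis .
qed

section \<open>Containers for independent sets\<close>

lemma card_small_subsets_le:
  assumes "finite V"
  shows "card {S. S \<subseteq> V \<and> card S \<le> k} \<le> (card V + 1) ^ k"
proof (induction k)
  case 0
  have "{S. S \<subseteq> V \<and> card S \<le> 0} = {{}}" using assms finite_subset by fastforce
  then show ?case by simp
next
  case (Suc k)
  define \<phi> where "\<phi> = (\<lambda>(S, x). case x of None \<Rightarrow> S | Some v \<Rightarrow> insert (v :: 'a) S)"
  let ?A = "{S. S \<subseteq> V \<and> card S \<le> k} \<times> insert None (Some ` V)"
  have fin: "finite ?A" using assms by auto
  have "{S. S \<subseteq> V \<and> card S \<le> Suc k} \<subseteq> \<phi> ` ?A"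
  proof
    fix S assume "S \<in> {S. S \<subseteq> V \<and> card S \<le> Suc k}"
    then have S: "S \<subseteq> V" "card S \<le> Suc k" "finite S" using assms finite_subset by auto
    show "S \<in> \<phi> ` ?A"
    proof (cases "card S \<le> k")
      case True
      then have "S = \<phi> (S, None)" "(S, None) \<in> ?A" using S by (auto simp: \<phi>_def)
      then show ?thesis by blast
    next
      case False
      then have "S \<noteq> {}" by auto
      then obtain v where v: "v \<in> S" by blast
      then have "S = \<phi> (S - {v}, Some v)" "(S - {v}, Some v) \<in> ?A"
        using S by (auto simp: \<phi>_def)
      then show ?thesis by blast
    qed
  qed
  then have "card {S. S \<subseteq> V \<and> card S \<le> Suc k} \<le> card ?A"
    using fin by (meson card_image_le card_mono finite_imageI order.trans)
  also have "\<dots> = card {S. S \<subseteq> V \<and> card S \<le> k} * (card V + 1)"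
    using assms by (simp add: card_cartesian_product card_image)
  also have "\<dots> \<le> (card V + 1) ^ k * (card V + 1)" using Suc by (intro mult_right_mono) auto
  finally show ?case by (simp add: mult.commute)
qed

definition nbhd :: "'a ugraph \<Rightarrow> 'a set \<Rightarrow> 'a set" where
  "nbhd G S = {v \<in> verts G. \<exists>u\<in>S. {u, v} \<in> edges G}"

text \<open>
  For a subset \<open>S\<close> of an independent set this superset of \<open>S\<close> depends on \<open>S\<close> only. A vertex of it has
  fewer than \<open>t\<close> neighbours within it, because the container avoids the neighbourhood of \<open>S\<close>.
\<close>

definition container :: "'a ugraph \<Rightarrow> real \<Rightarrow> 'a set \<Rightarrow> 'a set" where
  "container G t S = {v \<in> verts G - nbhd G S. real (card (nbhd G {v} - nbhd G S)) < t}"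

text \<open>
  Take for \<open>S\<close> a maximal subset of \<open>I\<close> whose neighbourhood has at least \<open>t * card S\<close> elements. A vertex of \<open>I\<close>
  with \<open>t\<close> or more neighbours outside the neighbourhood of \<open>S\<close> could be added to it.
\<close>

lemma independent_subset_container:
  fixes t :: real
  assumes V: "finite (verts G)" and I: "I \<subseteq> verts G"
    and indep: "\<And>u v. u \<in> I \<Longrightarrow> v \<in> I \<Longrightarrow> {u, v} \<notin> edges G" and t: "0 < t"
  shows "\<exists>S\<subseteq>I. t * card S \<le> card (verts G) \<and> I \<subseteq> container G t S"
proof -
  define \<S> where "\<S> = {S. S \<subseteq> I \<and> t * card S \<le> card (nbhd G S)}"
  have finI: "finite I" using I V finite_subset by blast
  have fN: "finite (nbhd G S)" for S using V by (simp add: nbhd_def)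
  have "finite \<S>" "{} \<in> \<S>" using finI by (auto simp: \<S>_def)
  then obtain S where S: "S \<in> \<S>" and max: "\<And>T. T \<in> \<S> \<Longrightarrow> S \<subseteq> T \<Longrightarrow> S = T"
    using finite_has_maximal[of \<S>] by blast
  have SI: "S \<subseteq> I" "t * card S \<le> card (nbhd G S)" using S by (auto simp: \<S>_def)
  have "card (nbhd G S) \<le> card (verts G)" using V by (intro card_mono) (auto simp: nbhd_def)
  then have "t * card S \<le> card (verts G)" using SI by linarith
  moreover have "v \<in> container G t S" if v: "v \<in> I" for v
  proof -
    have "v \<in> verts G - nbhd G S" using v I indep SI by (auto simp: nbhd_def)
    moreover have "real (card (nbhd G {v} - nbhd G S)) < t"
    proof (rule ccontr)
      assume "\<not> real (card (nbhd G {v} - nbhd G S)) < t"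
      then have big: "t \<le> card (nbhd G {v} - nbhd G S)" by simp
      have "v \<notin> S"
      proof
        assume "v \<in> S"
        then have "nbhd G {v} - nbhd G S = {}" by (auto simp: nbhd_def)
        then have "real (card (nbhd G {v} - nbhd G S)) = 0" by (simp only: card.empty of_nat_0)
        then show False using big t by linarith
      qed
      have "nbhd G (insert v S) = nbhd G S \<union> (nbhd G {v} - nbhd G S)" by (auto simp: nbhd_def)
      then have "card (nbhd G (insert v S)) = card (nbhd G S) + card (nbhd G {v} - nbhd G S)"
        using card_Un_disjoint[of "nbhd G S" "nbhd G {v} - nbhd G S"] fN by (metis Diff_disjoint finite_Diff)
      moreover have "card (insert v S) = card S + 1"
        using \<open>v \<notin> S\<close> SI finI finite_subset by (metis Suc_eq_plus1 card_insert_disjoint)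
      ultimately have "insert v S \<in> \<S>" using SI v big by (simp add: \<S>_def algebra_simps)
      then show False using max \<open>v \<notin> S\<close> by blast
    qed
    ultimately show ?thesis by (simp add: container_def)
  qed
  ultimately show ?thesis using SI by blast
qed

text \<open>
  The list of \<open>v\<close> consists of the colours whose container contains \<open>v\<close>. There are at most
  \<open>(n + 1) ^ (k * q)\<close> choices for the small sets that determine the containers of
  the \<open>q\<close> colour classes, and an edge with a common
  colour \<open>i\<close> in the lists of its ends lies inside the \<open>i\<close>-th container, where degrees are below \<open>t\<close>.
\<close>

lemma container_lists:
  fixes t :: real
  assumes G: "simple_graph G" and n: "card (verts G) = n" and pos: "0 < num_colorings G q"
    and t: "0 < t" and k: "real n \<le> t * real k"
  shows "\<exists>L. (\<forall>v\<in>verts G. L v \<subseteq> {..<q} \<and> L v \<noteq> {}) \<and>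
     num_colorings G q \<le> (n + 1) ^ (k * q) * 2 ^ (\<Sum>v\<in>verts G. card (L v) - 1) \<and>
     real (card {(u, v) \<in> arcs G. L u \<inter> L v \<noteq> {}}) \<le> real q * real n * t"
proof -
  note V = simple_graph_finite(1)[OF G]
  define \<F> where "\<F> = {S. S \<subseteq> verts G \<and> card S \<le> k}"
  define I where "I = {..<q} \<rightarrow>\<^sub>E \<F>"
  define L where "L S v = {i. i < q \<and> v \<in> container G t (S i)}" for S :: "nat \<Rightarrow> 'a set" and v
  have fF: "finite \<F>" using V by (auto simp: \<F>_def)
  have fI: "finite I" unfolding I_def using fF by (intro finite_PiE) auto
  have cover: "\<exists>S\<in>I. c \<in> Pi\<^sub>E (verts G) (L S)" if c: "c \<in> proper_colorings q G" for c
  proof -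
    have proper: "{u, v} \<notin> edges G" if "c u = c v" for u v
      using c that by (auto simp: proper_colorings_def)
    define J where "J i = {v \<in> verts G. c v = i}" for i
    have "\<forall>i. \<exists>S\<subseteq>J i. t * card S \<le> card (verts G) \<and> J i \<subseteq> container G t S"
      using proper by (intro allI independent_subset_container[OF V _ _ t]) (auto simp: J_def)
    then obtain S where S: "\<And>i. S i \<subseteq> J i" "\<And>i. t * card (S i) \<le> card (verts G)"
      "\<And>i. J i \<subseteq> container G t (S i)" by metis
    have "card (S i) \<le> k" for i
    proof -
      have "t * card (S i) \<le> t * k" using S(2)[of i] n k by linarith
      then show ?thesis using t by simp
    qed
    then have "restrict S {..<q} \<in> I" using S(1) by (auto simp: I_def \<F>_def J_def)
    moreover have "c v \<in> L (restrict S {..<q}) v" if "v \<in> verts G" for v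
    proof -
      have "c v < q" using c that by (auto simp: proper_colorings_def)
      moreover have "v \<in> container G t (S (c v))" using S(3) that by (auto simp: J_def)
      ultimately show ?thesis by (simp add: L_def)
    qed
    then have "c \<in> Pi\<^sub>E (verts G) (L (restrict S {..<q}))"
      using c by (auto simp: proper_colorings_def PiE_iff)
    ultimately show ?thesis by blast
  qed
  have "\<exists>S\<in>I. num_colorings G q \<le> card I * (\<Prod>v\<in>verts G. card (L S v))"
    by (rule num_colorings_le_best_lists[OF V fI pos _ cover]) (simp_all add: L_def)
  then obtain S where S: "S \<in> I" and le: "num_colorings G q \<le> card I * (\<Prod>v\<in>verts G. card (L S v))"
    by blast
  have "card I = card \<F> ^ q" unfolding I_def by (simp add: card_PiE)
  also have "\<dots> \<le> ((n + 1) ^ k) ^ q"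
    using card_small_subsets_le[OF V, of k] n by (intro power_mono) (auto simp: \<F>_def)
  finally have cI: "card I \<le> (n + 1) ^ (k * q)" by (simp add: power_mult)
  have nz: "0 < (\<Prod>v\<in>verts G. card (L S v))" using le pos by (cases "(\<Prod>v\<in>verts G. card (L S v)) = 0") auto
  have pcard: "0 < card (L S v)" if "v \<in> verts G" for v
    using nz that V by (metis gr0I less_irrefl prod_zero)
  show ?thesis
  proof (intro exI[of _ "L S"] conjI ballI)
    fix v assume v: "v \<in> verts G"
    show "L S v \<subseteq> {..<q}" by (auto simp: L_def)
    show "L S v \<noteq> {}" using pcard[OF v] by auto
  next
    show "num_colorings G q \<le> (n + 1) ^ (k * q) * 2 ^ (\<Sum>v\<in>verts G. card (L S v) - 1)"
      by (rule order.trans[OF le mult_le_mono[OF cI prod_card_le_power_two[OF pcard]]])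
  next
    define E where "E i = Sigma (container G t (S i)) (\<lambda>u. nbhd G {u} - nbhd G (S i))" for i
    have fin: "finite (container G t (S i))" "finite (nbhd G X)" for i X
      using V by (auto simp: container_def nbhd_def)
    have cE: "real (card (E i)) \<le> real n * t" for i
    proof -
      have "real (card (E i)) = (\<Sum>u\<in>container G t (S i). real (card (nbhd G {u} - nbhd G (S i))))"
        unfolding E_def using fin by (simp add: card_SigmaI)
      also have "\<dots> \<le> (\<Sum>u\<in>container G t (S i). t)"
        by (intro sum_mono) (auto simp: container_def)
      also have "\<dots> = card (container G t (S i)) * t" by simp
      also have "\<dots> \<le> real n * t"
      proof (intro mult_right_mono)
        have "card (container G t (S i)) \<le> n"
          unfolding n[symmetric] using V by (intro card_mono) (auto simp: container_def)
        then show "real (card (container G t (S i))) \<le> n" by simp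
      qed (use t in simp)
      finally show ?thesis .
    qed
    have "{(u, v) \<in> arcs G. L S u \<inter> L S v \<noteq> {}} \<subseteq> (\<Union>i<q. E i)"
      using simple_graph_edge[OF G] by (auto simp: arcs_def L_def E_def container_def nbhd_def)
    then have "card {(u, v) \<in> arcs G. L S u \<inter> L S v \<noteq> {}} \<le> card (\<Union>i<q. E i)"
      using fin by (intro card_mono) (auto simp: E_def)
    also have "\<dots> \<le> (\<Sum>i<q. card (E i))" by (intro card_UN_le) auto
    finally have "real (card {(u, v) \<in> arcs G. L S u \<inter> L S v \<noteq> {}}) \<le> (\<Sum>i<q. real (card (E i)))"
      by (simp only: of_nat_le_iff[symmetric, where 'a = real] of_nat_sum)
    also have "\<dots> \<le> (\<Sum>i<q. real n * t)" using cE by (intro sum_mono)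
    finally show "real (card {(u, v) \<in> arcs G. L S u \<inter> L S v \<noteq> {}}) \<le> real q * real n * t" by simp
  qed
qed

section \<open>Closeness to the Turan graph\<close>

lemma card_cross_pairs:
  fixes f :: "'a \<Rightarrow> nat"
  assumes V: "finite V" "card V = n" and f: "\<And>v. v \<in> V \<Longrightarrow> f v < s"
  shows "real (card {(u, v) \<in> V \<times> V. f u \<noteq> f v}) = (real n)\<^sup>2 - (\<Sum>i<s. (real (card {v \<in> V. f v = i}))\<^sup>2)"
    and "(\<Sum>i<s. card {v \<in> V. f v = i}) = n"
proof -
  define P where "P i = {v \<in> V. f v = i}" for i :: nat
  have fP: "finite (P i)" "P i \<subseteq> V" for i using V by (auto simp: P_def)
  have "(\<Union>i<s. P i) = V" using f by (auto simp: P_def)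
  then have "n = card (\<Union>i<s. P i)" using V by simp
  also have "\<dots> = (\<Sum>i<s. card (P i))"
    using fP by (intro card_UN_disjoint) (auto simp: P_def)
  finally show "(\<Sum>i<s. card {v \<in> V. f v = i}) = n" by (simp add: P_def)
  have "{(u, v) \<in> V \<times> V. f u \<noteq> f v} = V \<times> V - (\<Union>i<s. P i \<times> P i)"
    using f by (auto simp: P_def)
  moreover have "(\<Union>i<s. P i \<times> P i) \<subseteq> V \<times> V" using fP by auto
  moreover have "card (\<Union>i<s. P i \<times> P i) = (\<Sum>i<s. card (P i \<times> P i))"
    using fP by (intro card_UN_disjoint) (auto simp: P_def)
  moreover have "card (\<Union>i<s. P i \<times> P i) \<le> card (V \<times> V)"
    using V fP by (intro card_mono) auto
  ultimately have "real (card {(u, v) \<in> V \<times> V. f u \<noteq> f v})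
      = real (card (V \<times> V)) - real (\<Sum>i<s. card (P i \<times> P i))"
    using V fP by (simp add: card_Diff_subset of_nat_diff)
  then show "real (card {(u, v) \<in> V \<times> V. f u \<noteq> f v}) = (real n)\<^sup>2 - (\<Sum>i<s. (real (card {v \<in> V. f v = i}))\<^sup>2)"
    using V by (simp add: card_cartesian_product P_def power2_eq_square)
qed

lemma simple_complete_multipartite: "finite V \<Longrightarrow> simple_graph (complete_multipartite V f)"
  by (auto simp: simple_graph_def complete_multipartite_def card_2_iff)

lemma arcs_complete_multipartite:
  "arcs (complete_multipartite V f) = {(u, v) \<in> V \<times> V. f u \<noteq> f v}"
  by (auto simp: arcs_def complete_multipartite_def doubleton_eq_iff)

lemma turan_edges_ge:
  assumes s: "0 < s"
  shows "(1 - 1 / s) * (real n)\<^sup>2 - n \<le> 2 * card (edges (turan_graph s n))"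
proof -
  define p where "p i = card {v \<in> {..<n}. v mod s = i}" for i
  have part: "\<And>v. v \<in> {..<n} \<Longrightarrow> v mod s < s" using s by simp
  have p: "real (p i) \<le> n / s + 1" if "i < s" for i
  proof -
    have "p i \<le> n div s + 1" using card_turan_part[OF that, of n] by (simp add: p_def)
    then have "real (p i) \<le> real (n div s) + 1" by linarith
    also have "real (n div s) \<le> n / s" by (rule of_nat_div_le_of_nat)
    finally show ?thesis by simp
  qed
  have sp: "(\<Sum>i<s. p i) = n"
    using card_cross_pairs(2)[of "{..<n}" n "\<lambda>v. v mod s" s] s by (simp add: p_def)
  have "(\<Sum>i<s. (real (p i))\<^sup>2) \<le> (\<Sum>i<s. real (p i) * (n / s + 1))"
    using p by (intro sum_mono) (auto simp: power2_eq_square intro: mult_left_mono)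
  also have "\<dots> = real n * (n / s + 1)"
    unfolding sum_distrib_right[symmetric] using sp by (metis of_nat_sum)
  finally have "(\<Sum>i<s. (real (p i))\<^sup>2) \<le> real n * (n / s + 1)" .
  moreover have "real (2 * card (edges (turan_graph s n))) = (real n)\<^sup>2 - (\<Sum>i<s. (real (p i))\<^sup>2)"
    unfolding card_arcs[OF simple_graph_turan_graph, symmetric]
    using card_cross_pairs(1)[of "{..<n}" n "\<lambda>v. v mod s" s] s
    by (simp add: turan_graph_def arcs_complete_multipartite p_def)
  ultimately show ?thesis by (simp add: algebra_simps power2_eq_square)
qed

text \<open>
  Each part is matched with its residue class as far as the sizes allow; the leftover vertices are
  placed arbitrarily, and only they can end up in a wrong class.
\<close>

lemma partition_bijection:
  fixes f :: "'a \<Rightarrow> nat"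
  assumes V: "finite V" "card V = n" and f: "\<And>v. v \<in> V \<Longrightarrow> f v < s" and s: "0 < s"
  obtains g where "bij_betw g V {..<n}" and
    "card {v \<in> V. g v mod s \<noteq> f v} \<le> (\<Sum>i<s. card {v \<in> V. f v = i} - card {x \<in> {..<n}. x mod s = i})"
proof -
  define P where "P i = {v \<in> V. f v = i}" for i
  define Q where "Q i = {x \<in> {..<n}. x mod s = i}" for i
  define m where "m i = min (card (P i)) (card (Q i))" for i
  have fin: "finite (P i)" "finite (Q i)" for i using V by (auto simp: P_def Q_def)
  have "\<exists>A B h. A \<subseteq> P i \<and> card A = m i \<and> B \<subseteq> Q i \<and> bij_betw h A B" for i
  proof -
    obtain A where A: "A \<subseteq> P i" "card A = m i"
      using obtain_subset_with_card_n[of "m i" "P i"] by (auto simp: m_def)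
    obtain B where B: "B \<subseteq> Q i" "card B = m i"
      using obtain_subset_with_card_n[of "m i" "Q i"] by (auto simp: m_def)
    have "finite A" "finite B" using A B fin finite_subset by metis+
    then obtain h where "bij_betw h A B" using A B finite_same_card_bij by metis
    then show ?thesis using A B by blast
  qed
  then obtain A B h where A: "\<And>i. A i \<subseteq> P i" "\<And>i. card (A i) = m i"
    and B: "\<And>i. B i \<subseteq> Q i" and h: "\<And>i. bij_betw (h i) (A i) (B i)" by metis
  have finA: "finite (A i)" for i using A(1) fin finite_subset by metis
  define AA where "AA = (\<Union>i<s. A i)"
  define g0 where "g0 v = h (f v) v" for v
  have hB: "g0 v \<in> Q i \<and> f v = i" if "v \<in> A i" for v i
  proof -
    have "f v = i" using A(1) that by (auto simp: P_def)
    then show ?thesis using h[of i] B that by (auto simp: g0_def bij_betw_def)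
  qed
  have inj0: "inj_on g0 AA"
  proof (rule inj_onI)
    fix u v assume uv: "u \<in> AA" "v \<in> AA" "g0 u = g0 v"
    then obtain i j where ij: "u \<in> A i" "v \<in> A j" by (auto simp: AA_def)
    have "i = g0 u mod s" "j = g0 v mod s" using hB[OF ij(1)] hB[OF ij(2)] by (auto simp: Q_def)
    then have "i = j" using uv by simp
    then have "h i u = h i v" "u \<in> A i" "v \<in> A i"
      using uv ij hB[OF ij(1)] hB[OF ij(2)] by (auto simp: g0_def)
    then show "u = v" using h[of i] by (auto simp: bij_betw_def dest: inj_onD)
  qed
  have AAV: "AA \<subseteq> V" using A by (auto simp: AA_def P_def)
  have g0n: "g0 ` AA \<subseteq> {..<n}" using hB by (force simp: AA_def Q_def)
  have "card (V - AA) = card ({..<n} - g0 ` AA)"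
    using AAV V g0n inj0 by (simp add: card_Diff_subset finite_subset card_image)
  then obtain k where k: "bij_betw k (V - AA) ({..<n} - g0 ` AA)"
    using V finite_same_card_bij[of "V - AA" "{..<n} - g0 ` AA"] by auto
  define g where "g v = (if v \<in> AA then g0 v else k v)" for v
  have "bij_betw g AA (g0 ` AA)"
    using inj0 by (auto simp: bij_betw_def g_def inj_on_def)
  moreover have "bij_betw g (V - AA) ({..<n} - g0 ` AA)"
    using k by (subst bij_betw_cong[of _ g k]) (auto simp: g_def)
  ultimately have "bij_betw g (AA \<union> (V - AA)) (g0 ` AA \<union> ({..<n} - g0 ` AA))"
    by (rule bij_betw_combine) auto
  moreover have "AA \<union> (V - AA) = V" "g0 ` AA \<union> ({..<n} - g0 ` AA) = {..<n}"
    using AAV g0n by auto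
  ultimately have bij: "bij_betw g V {..<n}" by simp
  have "{v \<in> V. g v mod s \<noteq> f v} \<subseteq> (\<Union>i<s. P i - A i)"
  proof
    fix v assume v: "v \<in> {v \<in> V. g v mod s \<noteq> f v}"
    have "v \<notin> A (f v)"
    proof
      assume a: "v \<in> A (f v)"
      then have "g v = g0 v" using f v by (auto simp: g_def AA_def)
      then show False using v hB[OF a] by (auto simp: Q_def)
    qed
    then show "v \<in> (\<Union>i<s. P i - A i)" using v f by (auto simp: P_def)
  qed
  then have "card {v \<in> V. g v mod s \<noteq> f v} \<le> card (\<Union>i<s. P i - A i)"
    using fin by (intro card_mono) auto
  also have "\<dots> \<le> (\<Sum>i<s. card (P i - A i))" by (intro card_UN_le) auto
  also have "\<dots> = (\<Sum>i<s. card (P i) - card (Q i))"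
    using A finA by (intro sum.cong) (auto simp: card_Diff_subset m_def)
  finally show ?thesis using that[OF bij] by (simp add: P_def Q_def)
qed

lemma edit_distance_le:
  assumes "simple_graph \<lparr>verts = verts G, edges = F\<rparr>" "graph_iso \<lparr>verts = verts G, edges = F\<rparr> H"
  shows "edit_distance G H \<le> card ((edges G - F) \<union> (F - edges G))"
  unfolding edit_distance_def using assms by (intro Least_le) blast

lemma near_balanced:
  fixes p :: "nat \<Rightarrow> real"
  assumes s: "0 < s" and sum: "(\<Sum>i<s. p i) = n" and sq: "(\<Sum>i<s. (p i)\<^sup>2) \<le> n\<^sup>2 / s + c" and i: "i < s"
  shows "\<bar>p i - n / s\<bar> \<le> sqrt c"
proof -
  have "(\<Sum>i<s. (p i - n / s)\<^sup>2) = (\<Sum>i<s. (p i)\<^sup>2) - 2 * (n / s) * (\<Sum>i<s. p i) + s * (n / s)\<^sup>2"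
    unfolding sum_distrib_left
    by (simp add: power2_diff sum.distrib sum_subtractf mult_ac)
  also have "\<dots> = (\<Sum>i<s. (p i)\<^sup>2) - n\<^sup>2 / s"
    unfolding sum using s by (simp add: field_simps power2_eq_square)
  also have "\<dots> \<le> c" using sq by simp
  finally have "(\<Sum>i<s. (p i - n / s)\<^sup>2) \<le> c" .
  moreover have "(p i - n / s)\<^sup>2 \<le> (\<Sum>i<s. (p i - n / s)\<^sup>2)"
    using i by (intro member_le_sum) auto
  ultimately have "(p i - n / s)\<^sup>2 \<le> c" by linarith
  then show ?thesis using real_le_rsqrt by (metis power2_abs)
qed

text \<open>
  Up to a small multiple of \<open>\<theta> * n\<^sup>2\<close>, the graph has as many edges as any graph whose edges all run
  between \<open>s\<close> parts. Hence few pairs between parts are missing, and by convexity the parts have almost equal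
  sizes, so that few vertices have to be moved to turn the partition into the Turan partition.
\<close>

lemma close_to_turan_if_partition:
  fixes G :: "'a ugraph" and f :: "'a \<Rightarrow> nat"
  assumes G: "simple_graph G" and n: "card (verts G) = n" and s: "0 < s"
    and f: "\<And>v. v \<in> verts G \<Longrightarrow> f v < s" and th: "0 \<le> \<theta>"
    and inside: "real (card {(u, v) \<in> arcs G. f u = f v}) \<le> \<theta> * (real n)\<^sup>2"
    and many: "(1 - 1 / s - \<theta>) * (real n)\<^sup>2 \<le> 2 * card (edges G)"
  shows "close_to ((2 * \<theta> + s * sqrt (2 * \<theta>)) * (real n)\<^sup>2 + real s * real n) G (turan_graph s n)"
proof -
  define V where "V = verts G"
  have V: "finite V" "card V = n" using simple_graph_finite[OF G] n by (auto simp: V_def)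
  define p where "p i = card {v \<in> V. f v = i}" for i
  define K where "K = {(u, v) \<in> V \<times> V. f u \<noteq> f v}"
  define A where "A = {(u, v) \<in> arcs G. f u = f v}"
  have fV: "f v < s" if "v \<in> V" for v using f that by (simp add: V_def)
  have cK: "real (card K) = (real n)\<^sup>2 - (\<Sum>i<s. (real (p i))\<^sup>2)"
    unfolding K_def p_def by (rule card_cross_pairs(1)[OF V fV])
  have sp: "(\<Sum>i<s. real (p i)) = n"
    by (simp only: of_nat_sum[symmetric] p_def card_cross_pairs(2)[OF V fV])
  have sub: "arcs G \<subseteq> V \<times> V" using arcs_subset[OF G] by (simp add: V_def)
  have finVV: "finite (V \<times> V)" using V by simp
  have fin: "finite K" "finite A" "finite (arcs G)"
    by (rule finite_subset[OF _ finVV], use sub in \<open>auto simp: K_def A_def\<close>)+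
  have "arcs G = A \<union> (arcs G \<inter> K)" "A \<inter> (arcs G \<inter> K) = {}" using sub by (auto simp: A_def K_def)
  then have "card (arcs G) = card A + card (arcs G \<inter> K)"
    using fin by (metis card_Un_disjoint finite_Int)
  then have GK: "(1 - 1 / s - 2 * \<theta>) * (real n)\<^sup>2 \<le> card (arcs G \<inter> K)"
    using many inside card_arcs[OF G] by (simp add: A_def algebra_simps)
  have "card (arcs G \<inter> K) \<le> card K" using fin by (intro card_mono) auto
  then have sq: "(\<Sum>i<s. (real (p i))\<^sup>2) \<le> (real n)\<^sup>2 / s + 2 * \<theta> * (real n)\<^sup>2"
    using GK cK by (simp add: algebra_simps)
  have "(real n)\<^sup>2 \<le> s * (\<Sum>i<s. (real (p i))\<^sup>2)"
    using sum_squared_le_sum_of_squares[of "\<lambda>i. real (p i)" "{..<s}"] sp by (simp add: mult.commute)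
  then have "(real n)\<^sup>2 / s \<le> (\<Sum>i<s. (real (p i))\<^sup>2)" using s by (simp add: field_simps)
  then have cKle: "card K \<le> (1 - 1 / s) * (real n)\<^sup>2" using cK by (simp add: algebra_simps)
  obtain g where g: "bij_betw g V {..<n}"
    and mis: "card {v \<in> V. g v mod s \<noteq> f v} \<le> (\<Sum>i<s. card {v \<in> V. f v = i} - card {x \<in> {..<n}. x mod s = i})"
    by (rule partition_bijection[OF V fV s])
  define X where "X = {v \<in> V. g v mod s \<noteq> f v}"
  have "real (card X) \<le> real (\<Sum>i<s. p i - card {x \<in> {..<n}. x mod s = i})"
    using mis by (simp only: of_nat_le_iff X_def p_def)
  also have "\<dots> \<le> (\<Sum>i<s. sqrt (2 * \<theta>) * n + 1)"
    unfolding of_nat_sum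
  proof (intro sum_mono)
    fix i assume "i \<in> {..<s}"
    then have i: "i < s" by simp
    have "\<bar>real (p i) - n / s\<bar> \<le> sqrt (2 * \<theta> * (real n)\<^sup>2)" by (rule near_balanced[OF s sp sq i])
    then have "real (p i) \<le> n / s + sqrt (2 * \<theta>) * n" by (simp add: real_sqrt_mult)
    moreover have "n / s - 1 \<le> real (card {x \<in> {..<n}. x mod s = i})"
    proof -
      have "n = s * (n div s) + n mod s" "n mod s < s" using s by simp_all
      then have "real n \<le> real (s * (n div s) + s)" by (simp only: of_nat_le_iff)
      then have "real n / s - 1 \<le> real (n div s)" using s by (simp add: field_simps)
      then show ?thesis using card_turan_part[OF i, of n] by simp
    qed
    moreover have "0 \<le> sqrt (2 * \<theta>) * n" using th by simp
    ultimately show "real (p i - card {x \<in> {..<n}. x mod s = i}) \<le> sqrt (2 * \<theta>) * n + 1"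
      by (cases "card {x \<in> {..<n}. x mod s = i} \<le> p i") (simp_all add: of_nat_diff)
  qed
  finally have cX: "real (card X) \<le> s * (sqrt (2 * \<theta>) * n + 1)" by simp
  define F where "F = {{u, v} | u v. u \<in> V \<and> v \<in> V \<and> g u mod s \<noteq> g v mod s}"
  have sF: "simple_graph \<lparr>verts = V, edges = F\<rparr>"
    using V by (auto simp: simple_graph_def F_def card_2_iff)
  have iso: "graph_iso \<lparr>verts = V, edges = F\<rparr> (turan_graph s n)"
    unfolding graph_iso_def
  proof (intro exI[of _ g] conjI)
    show "bij_betw g (verts \<lparr>verts = V, edges = F\<rparr>) (verts (turan_graph s n))"
      using g by (simp add: turan_graph_def complete_multipartite_def)
    have gV: "g ` V = {..<n}" using g by (simp add: bij_betw_def)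
    have "(`) g ` F = {{g u, g v} | u v. u \<in> V \<and> v \<in> V \<and> g u mod s \<noteq> g v mod s}"
      by (auto simp: F_def image_iff) (metis image_empty image_insert)
    also have "\<dots> = {{x, y} | x y. x \<in> g ` V \<and> y \<in> g ` V \<and> x mod s \<noteq> y mod s}" by blast
    finally show "(`) g ` edges \<lparr>verts = V, edges = F\<rparr> = edges (turan_graph s n)"
      using gV by (simp add: turan_graph_def complete_multipartite_def)
  qed
  define Z where "Z = \<lparr>verts = V, edges = (edges G - F) \<union> (F - edges G)\<rparr>"
  have sZ: "simple_graph Z" using G sF unfolding Z_def simple_graph_def V_def by auto
  have Fuv: "{u, v} \<in> F \<longleftrightarrow> u \<in> V \<and> v \<in> V \<and> g u mod s \<noteq> g v mod s" for u v
    by (auto simp: F_def doubleton_eq_iff)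
  have "arcs Z \<subseteq> A \<union> (K - arcs G) \<union> X \<times> V \<union> V \<times> X"
  proof
    fix e assume e: "e \<in> arcs Z"
    then obtain u v where uv: "e = (u, v)" by (cases e)
    have V2: "u \<in> V" "v \<in> V" using e uv arcs_subset[OF sZ] by (auto simp: Z_def)
    show "e \<in> A \<union> (K - arcs G) \<union> X \<times> V \<union> V \<times> X"
    proof (cases "u \<in> X \<or> v \<in> X")
      case False
      then have "g u mod s = f u" "g v mod s = f v" using V2 by (auto simp: X_def)
      then show ?thesis using e uv V2 Fuv[of u v] by (auto simp: arcs_def Z_def A_def K_def)
    qed (use uv V2 in auto)
  qed
  then have "card (arcs Z) \<le> card (A \<union> (K - arcs G) \<union> X \<times> V \<union> V \<times> X)"
    using V fin by (intro card_mono) (auto simp: X_def)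
  also have "\<dots> \<le> card A + card (K - arcs G) + card (X \<times> V) + card (V \<times> X)"
    by (intro order.trans[OF card_Un_le] add_mono order.refl)
  also have "card (K - arcs G) = card K - card (arcs G \<inter> K)"
    using fin by (simp add: card_Diff_subset_Int Int_commute)
  finally have "2 * card (edges Z) \<le> card A + (card K - card (arcs G \<inter> K)) + 2 * (card X * n)"
    using V by (simp add: card_arcs[OF sZ] card_cartesian_product mult.commute)
  then have "real (2 * card (edges Z)) \<le> real (card A + (card K - card (arcs G \<inter> K)) + 2 * (card X * n))"
    by (simp only: of_nat_le_iff)
  also have "\<dots> = real (card A) + (real (card K) - real (card (arcs G \<inter> K))) + 2 * (real (card X) * n)"
    using \<open>card (arcs G \<inter> K) \<le> card K\<close> by (simp add: of_nat_diff)
  also have "\<dots> \<le> \<theta> * (real n)\<^sup>2 + ((1 - 1 / s) * (real n)\<^sup>2 - (1 - 1 / s - 2 * \<theta>) * (real n)\<^sup>2)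
      + 2 * (s * (sqrt (2 * \<theta>) * n + 1) * n)"
    using inside cKle GK cX by (intro add_mono diff_mono mult_left_mono mult_right_mono) (auto simp: A_def)
  also have "\<dots> = 3 * \<theta> * (real n)\<^sup>2 + 2 * (s * sqrt (2 * \<theta>) * (real n)\<^sup>2 + s * n)"
    by (simp add: algebra_simps power2_eq_square)
  finally have "real (card (edges Z)) \<le> 3 / 2 * \<theta> * (real n)\<^sup>2 + (s * sqrt (2 * \<theta>) * (real n)\<^sup>2 + s * n)"
    by simp
  moreover have "0 \<le> \<theta> * (real n)\<^sup>2" using th by simp
  ultimately have "real (card (edges Z)) \<le> (2 * \<theta> + s * sqrt (2 * \<theta>)) * (real n)\<^sup>2 + s * n"
    by (simp add: algebra_simps)
  moreover have "edit_distance G (turan_graph s n) \<le> card (edges Z)"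
    using edit_distance_le[of G F "turan_graph s n"] sF iso by (simp add: V_def Z_def)
  ultimately show ?thesis
    using n unfolding close_to_def by (simp add: turan_graph_def complete_multipartite_def)
qed

section \<open>Extremal graphs\<close>

text \<open>
  The Turan graph together with a complete bipartite graph between two sets \<open>W\<close>, \<open>W'\<close> of size \<open>k\<close>
  inside one part has \<open>k\<^sup>2\<close> additional edges. The colour \<open>i + s\<close> serves as the second colour of the
  \<open>i\<close>-th part for \<open>i < b\<close>; fixing the first colour on \<open>W\<close> and the second one on \<open>W'\<close> costs only
  \<open>2 * k\<close> of the binary choices. Deleting edges adjusts their number without losing colourings.
\<close>

lemma exists_denser_graph_with_many_colorings:
  fixes s b n k m :: nat
  assumes s: "2 \<le> s" and b: "0 < b" "b \<le> s" and k: "2 * s * k \<le> n"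
    and m: "m \<le> card (edges (turan_graph s n)) + k\<^sup>2"
  shows "\<exists>H :: nat ugraph. simple_graph H \<and> card (verts H) = n \<and> card (edges H) = m \<and>
    2 ^ (b * (n div s) - 2 * k) \<le> num_colorings H (s + b)"
proof -
  define W where "W = (\<lambda>j. j * (2 * s)) ` {..<k}"
  define W' where "W' = (\<lambda>j. j * (2 * s) + s) ` {..<k}"
  define L where "L v = (if v \<in> W then {0} else if v \<in> W' then {s}
    else insert (v mod s) (if v mod s < b then {v mod s + s} else {}))" for v
  have modW: "v mod s = 0" "v mod (2 * s) = 0" if "v \<in> W" for v
    using that by (auto simp: W_def)
  have modW': "v mod s = 0" "v mod (2 * s) = s" if "v \<in> W'" for v
    using that s by (auto simp: W'_def)
  have disjW: "W \<inter> W' = {}" using modW(2) modW'(2) s by fastforce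
  have sub: "W \<subseteq> {..<n}" "W' \<subseteq> {..<n}"
  proof -
    have "j * (2 * s) + s < n" if "j < k" for j
    proof -
      have "(j + 1) * (2 * s) \<le> k * (2 * s)" using that by (intro mult_right_mono) auto
      then have "j * (2 * s) + 2 * s \<le> n" using k by (simp add: algebra_simps)
      then show ?thesis using s by linarith
    qed
    then show "W \<subseteq> {..<n}" "W' \<subseteq> {..<n}" unfolding W_def W'_def by fastforce+
  qed
  have cW: "card W = k" "card W' = k"
    unfolding W_def W'_def using s by (auto simp: card_image inj_on_def)
  have fin: "finite W" "finite W'" by (auto simp: W_def W'_def)
  have Lmod: "i mod s = v mod s" if "i \<in> L v" for i v
    using that modW modW' by (auto simp: L_def split: if_splits)
  have Lq: "L v \<subseteq> {..<s + b}" for v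
  proof -
    have "v mod s < s + b" using s by (intro trans_less_add1) simp
    then show ?thesis using b s by (auto simp: L_def)
  qed
  define H0 where "H0 = \<lparr>verts = {..<n}, edges = {{u, v} | u v. u < n \<and> v < n \<and> L u \<inter> L v = {}}\<rparr>"
  have Lne: "L v \<noteq> {}" for v by (simp add: L_def)
  have sH0: "simple_graph H0" using Lne by (fastforce simp: simple_graph_def H0_def card_2_iff)
  define EW where "EW = (\<lambda>(w, w'). {w, w'}) ` (W \<times> W')"
  have cEW: "card EW = k\<^sup>2"
  proof -
    have "inj_on (\<lambda>(w, w'). {w, w'}) (W \<times> W')"
      using disjW by (auto simp: inj_on_def doubleton_eq_iff)
    then show ?thesis unfolding EW_def by (simp add: card_image card_cartesian_product cW power2_eq_square)
  qed
  have "edges (turan_graph s n) \<subseteq> edges H0"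
  proof -
    have "L u \<inter> L v = {}" if "u mod s \<noteq> v mod s" for u v using Lmod that by (metis disjoint_iff)
    then show ?thesis
      unfolding turan_graph_def complete_multipartite_def H0_def ugraph.select_convs by blast
  qed
  moreover have "EW \<subseteq> edges H0"
  proof
    fix e assume "e \<in> EW"
    then obtain w w' where w: "e = {w, w'}" "w \<in> W" "w' \<in> W'" by (auto simp: EW_def)
    then have "w' \<notin> W" using disjW by auto
    then have "L w \<inter> L w' = {}" using w s by (simp add: L_def)
    moreover have "w < n" "w' < n" using w sub by auto
    ultimately show "e \<in> edges H0" using w(1) unfolding H0_def by auto
  qed
  moreover have "edges (turan_graph s n) \<inter> EW = {}"
    using modW(1) modW'(1) by (auto simp: turan_graph_def complete_multipartite_def EW_def doubleton_eq_iff)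
  moreover have "finite (edges (turan_graph s n))" "finite EW"
    using simple_graph_finite(2)[OF simple_graph_turan_graph] fin by (auto simp: EW_def)
  ultimately have "card (edges (turan_graph s n)) + card EW \<le> card (edges H0)"
    using card_mono[OF simple_graph_finite(2)[OF sH0], of "edges (turan_graph s n) \<union> EW"]
    by (simp add: card_Un_disjoint)
  then have "m \<le> card (edges H0)" using m cEW by simp
  then obtain F where F: "F \<subseteq> edges H0" "card F = m"
    using obtain_subset_with_card_n by metis
  define H where "H = \<lparr>verts = {..<n}, edges = F\<rparr>"
  have sH: "simple_graph H" using simple_graph_remove_edges[OF sH0 F(1)] by (simp add: H_def H0_def)
  define D where "D = {v \<in> {..<n}. v mod s < b} - (W \<union> W')"
  have "b * (n div s) - 2 * k \<le> card D"
  proof -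
    have "{v \<in> {..<n}. v mod s < b} = (\<Union>i<b. {v \<in> {..<n}. v mod s = i})" by auto
    then have "card {v \<in> {..<n}. v mod s < b} = (\<Sum>i<b. card {v \<in> {..<n}. v mod s = i})"
      by (simp only:) (intro card_UN_disjoint, auto)
    moreover have "(\<Sum>i<b. n div s) \<le> (\<Sum>i<b. card {v \<in> {..<n}. v mod s = i})"
    proof (intro sum_mono)
      fix i assume "i \<in> {..<b}"
      then have "i < s" using b by simp
      then show "n div s \<le> card {v \<in> {..<n}. v mod s = i}" by (simp only: card_turan_part le_add1)
    qed
    moreover have "card (W \<union> W') \<le> 2 * k" using card_Un_le[of W W'] cW by simp
    moreover have "card {v \<in> {..<n}. v mod s < b} - card (W \<union> W') \<le> card D"
      unfolding D_def using fin by (intro diff_card_le_card_Diff) auto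
    ultimately show ?thesis by simp
  qed
  then have "(2::nat) ^ (b * (n div s) - 2 * k) \<le> 2 ^ card D" by (intro power_increasing) auto
  also have "\<dots> \<le> (\<Prod>v\<in>verts H. card (L v))"
  proof (intro prod_ge_power_two)
    fix v assume v: "v \<in> D"
    then have "L v = {v mod s, v mod s + s}" by (auto simp: D_def L_def)
    then show "2 \<le> card (L v)" using s by simp
  next
    fix v
    have "finite (L v)" using Lq finite_subset by blast
    then show "1 \<le> card (L v)" using Lne[of v] by (simp add: Suc_le_eq card_gt_0_iff)
  qed (auto simp: H_def D_def)
  also have "\<dots> \<le> num_colorings H (s + b)"
  proof (rule prod_lists_le_num_colorings[OF sH Lq])
    fix u v assume "{u, v} \<in> edges H"
    then have "{u, v} \<in> edges H0" using F by (auto simp: H_def)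
    then show "L u \<inter> L v = {}" by (auto simp: H0_def doubleton_eq_iff)
  qed
  finally have "2 ^ (b * (n div s) - 2 * k) \<le> num_colorings H (s + b)" .
  then show ?thesis using sH F by (intro exI[of _ H]) (simp add: H_def)
qed

text \<open>
  With at most \<open>x\<^sup>2 * n\<^sup>2 / 2\<close> edges above the Turan density it suffices to take \<open>k\<close> close to \<open>x * n\<close> in
  the previous lemma. If \<open>q = s\<close>, the Turan density may be exceeded by graphs without any colouring,
  and the bound is just the existence of a colouring.
\<close>

lemma extremal_many_colorings:
  fixes s b n :: nat and x :: real and G :: "nat ugraph"
  assumes s: "2 \<le> s" and b: "b \<le> 2" and x: "0 < x" "x \<le> 1 / (4 * s)"
    and n1: "4 * real s \<le> n" and n2: "1 \<le> x\<^sup>2 * n"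
    and G: "extremal (s + b) G" "card (verts G) = n" and pos: "b = 0 \<longrightarrow> 0 < num_colorings G (s + b)"
    and m: "real (card (edges G)) \<le> (1 - 1 / s) / 2 * (real n)\<^sup>2 + x\<^sup>2 / 2 * (real n)\<^sup>2"
  shows "\<exists>y :: nat. 2 ^ y \<le> num_colorings G (s + b) \<and> b * real n / s - 4 - 2 * x * n \<le> y"
proof (cases "b = 0")
  case True
  moreover have "0 \<le> x * n" using x by simp
  ultimately show ?thesis using pos by (intro exI[of _ 0]) auto
next
  case False
  define k where "k = nat \<lceil>x * n\<rceil>"
  have k: "x * n \<le> k" "k \<le> x * n + 1"
    using x by (auto simp: k_def)
  have "x * n \<le> 1 / (4 * s) * n" using x by (intro mult_right_mono) auto
  then have "4 * s * (x * n) \<le> n" using s by (simp add: field_simps)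
  moreover have "real (4 * s * k) \<le> 4 * s * (x * n) + 4 * s"
    using mult_left_mono[OF k(2), of "4 * s"] by (simp add: algebra_simps)
  ultimately have "real (4 * s * k) \<le> 2 * real n" using n1 by linarith
  then have "real (4 * s * k) \<le> real (2 * n)" by simp
  then have "4 * s * k \<le> 2 * n" by (simp only: of_nat_le_iff)
  moreover have "4 * s * k = 2 * (2 * s * k)" by simp
  ultimately have kn: "2 * s * k \<le> n" by linarith
  have "real n \<le> x\<^sup>2 * (real n)\<^sup>2" using mult_right_mono[OF n2, of n] by (simp add: power2_eq_square mult.assoc)
  moreover have "x\<^sup>2 * (real n)\<^sup>2 \<le> (real k)\<^sup>2"
    using k(1) x by (subst power_mult_distrib[symmetric]) (intro power_mono, auto)
  moreover have "2 * e \<le> c * N + d * N" if "e \<le> c / 2 * N + d / 2 * N" for c d e N :: real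
    using that by (simp add: field_simps)
  from this[OF m] have "2 * real (card (edges G)) \<le> (1 - 1 / s) * (real n)\<^sup>2 + x\<^sup>2 * (real n)\<^sup>2" .
  moreover have "(1 - 1 / s) * (real n)\<^sup>2 - n \<le> real (2 * card (edges (turan_graph s n)))"
    using s by (intro turan_edges_ge) auto
  ultimately have "2 * real (card (edges G)) \<le> 2 * real (card (edges (turan_graph s n))) + 2 * (real k)\<^sup>2"
    by simp
  then have "real (card (edges G)) \<le> real (card (edges (turan_graph s n)) + k\<^sup>2)" by simp
  then have "card (edges G) \<le> card (edges (turan_graph s n)) + k\<^sup>2" by (simp only: of_nat_le_iff)
  then obtain H :: "nat ugraph" where H: "simple_graph H" "card (verts H) = n"
    "card (edges H) = card (edges G)" "2 ^ (b * (n div s) - 2 * k) \<le> num_colorings H (s + b)"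
    using exists_denser_graph_with_many_colorings[OF s _ _ kn, of b] False b s by auto
  then have "num_colorings H (s + b) \<le> num_colorings G (s + b)"
    using G unfolding extremal_def by metis
  then have "2 ^ (b * (n div s) - 2 * k) \<le> num_colorings G (s + b)" using H by linarith
  moreover have "b * real n / s - 4 - 2 * x * n \<le> real (b * (n div s) - 2 * k)"
  proof -
    have "n = s * (n div s) + n mod s" "n mod s < s" using s by simp_all
    then have "real n \<le> real (s * (n div s) + s)" by (simp only: of_nat_le_iff)
    then have "real n / s \<le> real (n div s) + 1" using s by (simp add: field_simps)
    then have "b * (real n / s) \<le> b * (real (n div s) + 1)" by (intro mult_left_mono) auto
    then have "b * real n / s - 2 \<le> real (b * (n div s))" using b by (simp add: algebra_simps)
    moreover have "real (b * (n div s)) - real (2 * k) \<le> real (b * (n div s) - 2 * k)" by linarith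
    ultimately show ?thesis using k by simp
  qed
  ultimately show ?thesis by blast
qed

lemma list_excess_ge:
  fixes y Y n C :: nat
  assumes "2 ^ y \<le> (n + 1) ^ C * (2::nat) ^ Y"
  shows "real y - C * log 2 (n + 1) \<le> Y"
proof -
  have "real (2 ^ y) \<le> real ((n + 1) ^ C * 2 ^ Y)" using assms by (simp only: of_nat_le_iff)
  then have "log 2 (2 ^ y) \<le> log 2 ((real n + 1) ^ C * 2 ^ Y)" by (subst log_le_cancel_iff) (auto simp: add.commute)
  also have "\<dots> = C * log 2 (real n + 1) + Y"
    by (subst log_mult_pos) (auto simp: log_nat_power)
  finally show ?thesis by (simp add: log_nat_power add.commute)
qed

lemma extremal_graphs_near_turan:
  fixes s q :: nat
  assumes s: "1 < s" and q: "s \<le> q" "q \<le> s + 2" and eps: "0 < (\<epsilon> :: real)"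
  shows "\<exists>\<eta>::real. \<eta> > 0 \<and> (\<exists>n\<^sub>0::nat. \<forall>n\<ge>n\<^sub>0. \<forall>G :: nat ugraph.
            extremal q G \<and> card (verts G) = n \<and> (q = s \<longrightarrow> num_colorings G q > 0) \<and>
            \<bar>real (card (edges G)) - (real s - 1) / (2 * real s) * (real n)\<^sup>2\<bar> \<le> \<eta> * (real n)\<^sup>2 \<longrightarrow>
            close_to (\<epsilon> * (real n)\<^sup>2) G (turan_graph s n))"
proof -
  define b where "b = q - s"
  have b: "b \<le> 2" "q = s + b" and s2: "2 \<le> s" using s q by (auto simp: b_def)
  \<comment> \<open>With \<open>2 * \<theta> = w\<^sup>2\<close>, the distance from the Turan graph is at most \<open>(w + s * w) * n\<^sup>2 + s * n\<close>.\<close>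
  define w where "w = min 1 (\<epsilon> / (2 * (s + 1)))"
  have w: "0 < w" "w \<le> 1" "w * (s + 1) \<le> \<epsilon> / 2"
  proof -
    show "0 < w" "w \<le> 1" using eps by (auto simp: w_def)
    have "w * (s + 1) \<le> \<epsilon> / (2 * (s + 1)) * (s + 1)" by (intro mult_right_mono) (auto simp: w_def)
    also have "\<dots> = \<epsilon> / 2" by (simp add: field_simps)
    finally show "w * (s + 1) \<le> \<epsilon> / 2" by simp
  qed
  define \<theta> where "\<theta> = w\<^sup>2 / 2"
  have th: "0 < \<theta>" using w by (simp add: \<theta>_def)
  have th2: "2 * \<theta> + s * sqrt (2 * \<theta>) \<le> \<epsilon> / 2"
  proof -
    have "w * w \<le> w * 1" using w by (intro mult_left_mono) auto
    then have "2 * \<theta> + s * sqrt (2 * \<theta>) \<le> w + s * w" using w by (simp add: \<theta>_def power2_eq_square)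
    also have "\<dots> = w * (s + 1)" by (simp add: algebra_simps)
    finally show ?thesis using w(3) by linarith
  qed
  show ?thesis
  proof (rule list_stability[OF b s2, of "\<theta> / 2", where ?'a = nat])
    show "0 < \<theta> / 2" using th by simp
  next
    fix \<eta> :: real
    assume eta: "0 < \<eta>" and stab: "\<And>(V :: nat set) L n.
    \<lbrakk>finite V; card V = n; 1 \<le> \<eta> * n; \<And>v. v \<in> V \<Longrightarrow> L v \<subseteq> {..<q} \<and> L v \<noteq> {};
     real (card {(u, v) \<in> V \<times> V. L u \<inter> L v \<noteq> {}}) \<le> (1 / s + \<eta>) * (real n)\<^sup>2;
     b * real n / s - \<eta> * n \<le> real (\<Sum>v\<in>V. card (L v) - 1)\<rbrakk>
    \<Longrightarrow> \<exists>f. (\<forall>v\<in>V. f v < s) \<and>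
        real (card {(u, v) \<in> V \<times> V. f u = f v \<and> L u \<inter> L v = {}}) \<le> \<theta> / 2 * (real n)\<^sup>2"
    \<comment> \<open>Containers of degree below \<open>\<tau> * n\<close> leave at most \<open>q * \<tau> * n\<^sup>2\<close> conflicting arcs.\<close>
    define \<tau> where "\<tau> = min \<theta> \<eta> / (2 * q)"
    have tau: "0 < \<tau>" "q * \<tau> \<le> \<theta> / 2" "q * \<tau> \<le> \<eta> / 2"
      using th eta s q by (auto simp: \<tau>_def)
    define k where "k = nat \<lceil>1 / \<tau>\<rceil>"
    have "1 / \<tau> \<le> k" by (simp add: k_def real_nat_ceiling_ge)
    then have k: "1 \<le> \<tau> * k" using tau by (simp add: field_simps)
    \<comment> \<open>An excess of \<open>x\<^sup>2 * n\<^sup>2 / 2\<close> edges costs at most \<open>2 * x * n\<close> binary choices, so the number of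
      allowed extra edges is quadratic in the tolerated loss \<open>x\<close>.\<close>
    define x where "x = min (1 / (4 * s)) (min (\<eta> / 4) (min 1 \<theta>))"
    have x: "0 < x" "x \<le> 1 / (4 * s)" "x \<le> \<eta> / 4" "x \<le> 1" "x \<le> \<theta>"
      using s eta th by (auto simp: x_def)
    have xx: "x\<^sup>2 \<le> x" using x by (simp add: power2_eq_square mult_left_le)
    define C where "C = k * q"
    have lim: "((\<lambda>n. (4 + C * log 2 (real n + 1)) / real n) \<longlongrightarrow> 0) sequentially"
      by real_asymp
    have "\<forall>\<^sub>F n in sequentially. (4 + C * log 2 (real n + 1)) / real n < \<eta> / 2"
      using order_tendstoD(2)[OF lim, of "\<eta> / 2"] eta by simp
    moreover have "\<forall>\<^sub>F n in sequentially. r \<le> real n" for r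
      using filterlim_real_sequentially by (simp add: filterlim_at_top)
    ultimately have "\<forall>\<^sub>F n in sequentially. (4 + C * log 2 (real n + 1)) / real n < \<eta> / 2 \<and>
        4 * real s \<le> n \<and> 1 / x\<^sup>2 \<le> n \<and> 1 / \<eta> \<le> n \<and> 2 * s / \<epsilon> \<le> n"
      by (intro eventually_conj) auto
    then obtain n\<^sub>0 where n0: "\<And>n. n \<ge> n\<^sub>0 \<Longrightarrow> (4 + C * log 2 (real n + 1)) / real n < \<eta> / 2 \<and>
        4 * real s \<le> n \<and> 1 / x\<^sup>2 \<le> n \<and> 1 / \<eta> \<le> n \<and> 2 * s / \<epsilon> \<le> n"
      unfolding eventually_sequentially by blast
    show ?thesis
    proof (intro exI[of _ "x\<^sup>2 / 2"] conjI exI[of _ n\<^sub>0] allI impI)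
      show "0 < x\<^sup>2 / 2" using x by simp
    next
      fix n and G :: "nat ugraph"
      assume n: "n\<^sub>0 \<le> n" and H: "extremal q G \<and> card (verts G) = n \<and> (q = s \<longrightarrow> num_colorings G q > 0) \<and>
            \<bar>real (card (edges G)) - (real s - 1) / (2 * real s) * (real n)\<^sup>2\<bar> \<le> x\<^sup>2 / 2 * (real n)\<^sup>2"
      have sG: "simple_graph G" using H by (simp add: extremal_def)
      have n4: "4 * real s \<le> n" and nx: "1 \<le> x\<^sup>2 * n" and neta: "1 \<le> \<eta> * n" and neps: "s \<le> \<epsilon> / 2 * n"
        using n0[OF n] x eta eps by (auto simp: field_simps)
      have npos: "0 < n" using n4 s by simp
      have nlog: "4 + C * log 2 (real n + 1) < \<eta> / 2 * n" using n0[OF n] npos by (simp add: field_simps)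
      have half: "(real s - 1) / (2 * real s) = (1 - 1 / s) / 2" using s by (simp add: field_simps)
      have dev: "\<bar>real (card (edges G)) - (1 - 1 / s) / 2 * (real n)\<^sup>2\<bar> \<le> x\<^sup>2 / 2 * (real n)\<^sup>2"
        using H unfolding half by blast
      have "a \<le> b + c \<and> b - c \<le> a" if "\<bar>a - b\<bar> \<le> c" for a b c :: real
        using that by linarith
      from this[OF dev]
      have mle: "real (card (edges G)) \<le> (1 - 1 / s) / 2 * (real n)\<^sup>2 + x\<^sup>2 / 2 * (real n)\<^sup>2"
        and mge: "(1 - 1 / s) / 2 * (real n)\<^sup>2 - x\<^sup>2 / 2 * (real n)\<^sup>2 \<le> real (card (edges G))"
        by blast+
      have "\<exists>y :: nat. 2 ^ y \<le> num_colorings G (s + b) \<and> b * real n / s - 4 - 2 * x * n \<le> y"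
        using H b by (intro extremal_many_colorings[OF s2 b(1) x(1,2) n4 nx _ _ _ mle]) auto
      then obtain y :: nat where y: "2 ^ y \<le> num_colorings G q" "b * real n / s - 4 - 2 * x * n \<le> y"
        using b by auto
      have pos: "0 < num_colorings G q" using y by (metis gr0I le_zero_eq power_not_zero zero_neq_numeral)
      have "real n \<le> \<tau> * n * k" using mult_right_mono[OF k, of n] by (simp add: mult_ac)
      moreover have "0 < \<tau> * n" using tau npos by simp
      ultimately obtain L where L: "\<forall>v\<in>verts G. L v \<subseteq> {..<q} \<and> L v \<noteq> {}"
        "num_colorings G q \<le> (n + 1) ^ C * 2 ^ (\<Sum>v\<in>verts G. card (L v) - 1)"
        "real (card {(u, v) \<in> arcs G. L u \<inter> L v \<noteq> {}}) \<le> real q * real n * (\<tau> * n)"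
        using container_lists[OF sG _ pos, of n "\<tau> * n" k] H unfolding C_def by blast
      define V where "V = verts G"
      have V: "finite V" "card V = n" using simple_graph_finite[OF sG] H by (auto simp: V_def)
      have finVV: "finite (V \<times> V)" using V by simp
      have sub: "arcs G \<subseteq> V \<times> V" using arcs_subset[OF sG] by (simp add: V_def)
      define B where "B = {(u, v) \<in> arcs G. L u \<inter> L v \<noteq> {}}"
      have bad: "real (card B) \<le> q * \<tau> * (real n)\<^sup>2"
        using L(3) by (simp add: B_def power2_eq_square mult_ac)
      have bad1: "real (card B) \<le> \<theta> / 2 * (real n)\<^sup>2" and bad2: "real (card B) \<le> \<eta> / 2 * (real n)\<^sup>2"
        using bad mult_right_mono[OF tau(2), of "(real n)\<^sup>2"] mult_right_mono[OF tau(3), of "(real n)\<^sup>2"] by auto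
      have x2: "x\<^sup>2 * (real n)\<^sup>2 \<le> \<theta> * (real n)\<^sup>2" "x\<^sup>2 * (real n)\<^sup>2 \<le> \<eta> / 4 * (real n)\<^sup>2"
        using xx x by (intro mult_right_mono; simp)+
      have eta2: "0 \<le> \<eta> * (real n)\<^sup>2" using eta by simp
      have conf: "real (card {(u, v) \<in> V \<times> V. L u \<inter> L v \<noteq> {}}) \<le> (1 / s + \<eta>) * (real n)\<^sup>2"
      proof -
        have "{(u, v) \<in> V \<times> V. L u \<inter> L v \<noteq> {}} \<subseteq> (V \<times> V - arcs G) \<union> B" by (auto simp: B_def)
        then have "card {(u, v) \<in> V \<times> V. L u \<inter> L v \<noteq> {}} \<le> card ((V \<times> V - arcs G) \<union> B)"
          using finVV sub by (intro card_mono) (auto simp: B_def intro: finite_subset)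
        also have "\<dots> \<le> card (V \<times> V - arcs G) + card B" by (rule card_Un_le)
        also have "card (V \<times> V - arcs G) = card (V \<times> V) - card (arcs G)"
          using sub finVV by (intro card_Diff_subset) (auto intro: finite_subset)
        finally have "real (card {(u, v) \<in> V \<times> V. L u \<inter> L v \<noteq> {}}) \<le> real (card (V \<times> V) - card (arcs G) + card B)"
          by (simp only: of_nat_le_iff)
        also have "\<dots> = (real n)\<^sup>2 - 2 * real (card (edges G)) + real (card B)"
          using card_mono[OF finVV sub] V card_arcs[OF sG]
          by (simp add: of_nat_diff card_cartesian_product power2_eq_square)
        also have "\<dots> \<le> (1 / s + \<eta>) * (real n)\<^sup>2"
          using mge bad2 x2 eta2 by (simp add: algebra_simps)
        finally show ?thesis .
      qed
      have excess: "b * real n / s - \<eta> * n \<le> real (\<Sum>v\<in>V. card (L v) - 1)"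
      proof -
        have "2 ^ y \<le> (n + 1) ^ C * 2 ^ (\<Sum>v\<in>V. card (L v) - 1)" using y(1) L(2) by (simp add: V_def)
        then have "real y - C * log 2 (n + 1) \<le> (\<Sum>v\<in>V. card (L v) - 1)" by (rule list_excess_ge)
        moreover have "2 * x * n \<le> \<eta> / 2 * n" using x by (intro mult_right_mono) auto
        ultimately show ?thesis using y(2) nlog by (simp add: add.commute)
      qed
      obtain f where f: "\<forall>v\<in>V. f v < s"
        "real (card {(u, v) \<in> V \<times> V. f u = f v \<and> L u \<inter> L v = {}}) \<le> \<theta> / 2 * (real n)\<^sup>2"
        using stab[OF V neta _ conf excess] L(1) by (auto simp: V_def)
      have inside: "real (card {(u, v) \<in> arcs G. f u = f v}) \<le> \<theta> * (real n)\<^sup>2"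
      proof -
        have "{(u, v) \<in> arcs G. f u = f v} \<subseteq> {(u, v) \<in> V \<times> V. f u = f v \<and> L u \<inter> L v = {}} \<union> B"
          using sub by (auto simp: B_def)
        then have "card {(u, v) \<in> arcs G. f u = f v} \<le> card ({(u, v) \<in> V \<times> V. f u = f v \<and> L u \<inter> L v = {}} \<union> B)"
          by (rule card_mono[rotated]) (rule finite_subset[OF _ finVV], use sub in \<open>auto simp: B_def\<close>)
        also have "\<dots> \<le> card {(u, v) \<in> V \<times> V. f u = f v \<and> L u \<inter> L v = {}} + card B" by (rule card_Un_le)
        finally have "real (card {(u, v) \<in> arcs G. f u = f v})
            \<le> real (card {(u, v) \<in> V \<times> V. f u = f v \<and> L u \<inter> L v = {}} + card B)" by (simp only: of_nat_le_iff)
        then show ?thesis using f(2) bad1 by simp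
      qed
      have many: "(1 - 1 / s - \<theta>) * (real n)\<^sup>2 \<le> 2 * card (edges G)"
        using mge x2(1) by (simp add: algebra_simps)
      have "close_to ((2 * \<theta> + s * sqrt (2 * \<theta>)) * (real n)\<^sup>2 + real s * real n) G (turan_graph s n)"
        using f s th by (intro close_to_turan_if_partition[OF sG _ _ _ _ inside many]) (auto simp: H V_def)
      moreover have "(2 * \<theta> + s * sqrt (2 * \<theta>)) * (real n)\<^sup>2 \<le> \<epsilon> / 2 * (real n)\<^sup>2"
        using th2 by (intro mult_right_mono) auto
      moreover have "real s * n \<le> \<epsilon> / 2 * n * n" using neps by (intro mult_right_mono) auto
      ultimately show "close_to (\<epsilon> * (real n)\<^sup>2) G (turan_graph s n)"
        unfolding close_to_def by (simp add: power2_eq_square)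
    qed
  qed
qed

section \<open>Unbalanced multipartite graphs\<close>

lemma sum_mod_classes:
  assumes s: "0 < s"
  shows "(\<Sum>v<s * t. h (v mod s)) = t * (\<Sum>i<s. (h i :: nat))"
proof -
  have "(\<Sum>v<s * t. h (v mod s)) = (\<Sum>i<s. \<Sum>v\<in>{v \<in> {..<s * t}. v mod s = i}. h (v mod s))"
    using s by (intro sum.group[symmetric]) auto
  also have "\<dots> = (\<Sum>i<s. t * h i)"
  proof (intro sum.cong refl)
    fix i assume "i \<in> {..<s}"
    then have "card {v \<in> {..<s * t}. v mod s = i} = t" using card_turan_part[of i s "s * t"] s by simp
    moreover have "(\<Sum>v\<in>{v \<in> {..<s * t}. v mod s = i}. h (v mod s)) = (\<Sum>v\<in>{v \<in> {..<s * t}. v mod s = i}. h i)"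
      by (intro sum.cong) auto
    ultimately show "(\<Sum>v\<in>{v \<in> {..<s * t}. v mod s = i}. h (v mod s)) = t * h i" by simp
  qed
  finally show ?thesis by (simp add: sum_distrib_left)
qed

text \<open>
  A colouring assigns to each colour the part in which it occurs, if any; the value \<open>s\<close> stands for an
  unused colour. For a fixed assignment the parts have disjoint sets of colours, of sizes \<open>h i\<close> with
  \<open>(\<Sum>i<s. h i) \<le> q\<close>, and the product of the \<open>h i\<close> is at most \<open>2 ^ (q - s)\<close>.
\<close>

lemma num_colorings_turan_le:
  assumes s: "0 < s" and t: "0 < t" and q: "s \<le> q"
  shows "num_colorings (turan_graph s (s * t)) q \<le> (s + 1) ^ q * 2 ^ ((q - s) * t)"
proof (cases "num_colorings (turan_graph s (s * t)) q = 0")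
  case False
  define T where "T = turan_graph s (s * t)"
  have VT: "verts T = {..<s * t}" by (simp add: T_def turan_graph_def complete_multipartite_def)
  have edgeT: "{u, v} \<in> edges T \<longleftrightarrow> u < s * t \<and> v < s * t \<and> u mod s \<noteq> v mod s" for u v
    by (auto simp: T_def turan_graph_def complete_multipartite_def doubleton_eq_iff)
  define I where "I = {..<q} \<rightarrow>\<^sub>E {..s}"
  define L where "L g v = {i. i < q \<and> g i = v mod s}" for g :: "nat \<Rightarrow> nat" and v
  have finI: "finite I" by (auto simp: I_def intro: finite_PiE)
  have cover: "\<exists>g\<in>I. c \<in> Pi\<^sub>E (verts T) (L g)" if c: "c \<in> proper_colorings q T" for c
  proof -
    define g where "g = restrict (\<lambda>i. if \<exists>v<s * t. c v = i then (SOME v. v < s * t \<and> c v = i) mod s else s) {..<q}"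
    have "g \<in> I" using s by (auto simp: g_def I_def less_imp_le)
    moreover have "c v \<in> L g v" if v: "v < s * t" for v
    proof -
      have cq: "c v < q" using c v by (auto simp: proper_colorings_def VT)
      define u where "u = (SOME u. u < s * t \<and> c u = c v)"
      have u: "u < s * t \<and> c u = c v" unfolding u_def using v by (intro someI_ex[of "\<lambda>u. u < s * t \<and> c u = c v"]) auto
      then have "{u, v} \<notin> edges T" using c by (auto simp: proper_colorings_def)
      then have "u mod s = v mod s" using u v by (simp add: edgeT)
      moreover have "g (c v) = u mod s" using v cq by (auto simp: g_def u_def)
      ultimately show ?thesis using cq by (simp add: L_def)
    qed
    moreover have "c \<in> extensional (verts T)" using c by (auto simp: proper_colorings_def PiE_def)
    ultimately show ?thesis by (intro bexI[of _ g]) (auto simp: PiE_iff VT)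
  qed
  have "\<exists>g\<in>I. num_colorings T q \<le> card I * (\<Prod>v\<in>verts T. card (L g v))"
    using False by (intro num_colorings_le_best_lists[OF _ finI _ _ cover]) (auto simp: L_def T_def VT[unfolded T_def])
  then obtain g where g: "g \<in> I" "num_colorings T q \<le> card I * (\<Prod>v<s * t. card (L g v))"
    by (auto simp: VT)
  define h where "h i = card {j. j < q \<and> g j = i}" for i
  have Lh: "card (L g v) = h (v mod s)" for v by (simp add: L_def h_def)
  have nz: "(\<Prod>v<s * t. card (L g v)) \<noteq> 0" using g False unfolding T_def by (metis le_zero_eq mult_0_right)
  then have pos: "0 < card (L g v)" if "v < s * t" for v using that by auto
  have hpos: "0 < h i" if "i < s" for i
  proof -
    have "s * 1 \<le> s * t" using t by (intro mult_left_mono) auto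
    then have "i < s * t" using that by linarith
    then show ?thesis using pos[of i] that by (simp add: Lh)
  qed
  have "(\<Sum>i<s. h i - 1) + s = (\<Sum>i<s. (h i - 1) + 1)" by (simp only: sum.distrib) simp
  also have "\<dots> = (\<Sum>i<s. h i)" using hpos by (intro sum.cong) (auto simp: Suc_le_eq)
  also have "\<dots> = card (\<Union>i<s. {j. j < q \<and> g j = i})"
    unfolding h_def by (intro card_UN_disjoint[symmetric]) auto
  also have "\<dots> \<le> card {..<q}" by (intro card_mono) auto
  finally have hs: "(\<Sum>i<s. h i - 1) \<le> q - s" by simp
  have "(\<Prod>v<s * t. card (L g v)) \<le> 2 ^ (\<Sum>v<s * t. card (L g v) - 1)"
    using pos by (intro prod_card_le_power_two) auto
  also have "(\<Sum>v<s * t. card (L g v) - 1) = t * (\<Sum>i<s. h i - 1)"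
    using sum_mod_classes[OF s, of "\<lambda>i. h i - 1" t] by (simp add: Lh)
  also have "(2::nat) ^ \<dots> \<le> 2 ^ ((q - s) * t)"
    using hs by (intro power_increasing) (auto simp: mult.commute)
  finally have P: "(\<Prod>v<s * t. card (L g v)) \<le> 2 ^ ((q - s) * t)" .
  have "card I = (s + 1) ^ q" by (simp add: I_def card_PiE)
  then show ?thesis using order.trans[OF g(2) mult_le_mono2[OF P, of "card I"]] by (simp add: T_def)
qed simp

lemma exists_two_size_partition:
  fixes x w j l :: nat
  assumes x: "0 < x" and w: "0 < w"
  shows "\<exists>f. (\<forall>v<j * x + l * w. f v < j + l) \<and>
    (\<forall>i<j. card {v \<in> {..<j * x + l * w}. f v = i} = x) \<and>
    (\<forall>i. j \<le> i \<longrightarrow> i < j + l \<longrightarrow> card {v \<in> {..<j * x + l * w}. f v = i} = w)"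
proof -
  define f where "f v = (if v < j * x then v div x else j + (v - j * x) div w)" for v
  have small: "v div x < j" if "v < j * x" for v using that by (simp add: less_mult_imp_div_less)
  have "f v < j + l" if "v < j * x + l * w" for v
  proof (cases "v < j * x")
    case True
    then show ?thesis using small[of v] by (simp add: f_def)
  next
    case False
    then have "(v - j * x) div w < l" using that by (intro less_mult_imp_div_less) linarith
    then show ?thesis using False by (simp add: f_def)
  qed
  moreover have "card {v \<in> {..<j * x + l * w}. f v = i} = x" if i: "i < j" for i
  proof -
    have "{v \<in> {..<j * x + l * w}. f v = i} = {i * x..<i * x + x}"
    proof (intro set_eqI iffI)
      fix v assume v: "v \<in> {v \<in> {..<j * x + l * w}. f v = i}"
      then have "v < j * x" using i by (auto simp: f_def split: if_splits)
      then have "v div x = i" using v by (simp add: f_def)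
      then show "v \<in> {i * x..<i * x + x}" using x
        by (metis add.commute atLeastLessThan_iff div_times_less_eq_dividend dividend_less_times_div mult.commute)
    next
      fix v assume v: "v \<in> {i * x..<i * x + x}"
      have "(i + 1) * x \<le> j * x" using i by (intro mult_right_mono) auto
      then have "v < j * x" using v by simp
      moreover have "v div x = i" using v by (intro div_nat_eqI) (auto simp: mult.commute)
      ultimately show "v \<in> {v \<in> {..<j * x + l * w}. f v = i}" by (simp add: f_def)
    qed
    then show ?thesis by simp
  qed
  moreover have "card {v \<in> {..<j * x + l * w}. f v = i} = w" if i: "j \<le> i" "i < j + l" for i
  proof -
    define k where "k = i - j"
    have k: "i = j + k" "k < l" using i by (auto simp: k_def)
    have "{v \<in> {..<j * x + l * w}. f v = i} = {j * x + k * w..<j * x + k * w + w}"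
    proof (intro set_eqI iffI)
      fix v assume v: "v \<in> {v \<in> {..<j * x + l * w}. f v = i}"
      then have nv: "\<not> v < j * x" using small[of v] k by (auto simp: f_def split: if_splits)
      then have "(v - j * x) div w = k" using v k by (simp add: f_def)
      then have "k * w \<le> v - j * x" "v - j * x < k * w + w" using w
        by (metis div_times_less_eq_dividend, metis add.commute dividend_less_times_div mult.commute)
      then show "v \<in> {j * x + k * w..<j * x + k * w + w}" using nv by auto
    next
      fix v assume v: "v \<in> {j * x + k * w..<j * x + k * w + w}"
      have "(k + 1) * w \<le> l * w" using k by (intro mult_right_mono) auto
      then have "v < j * x + l * w" "\<not> v < j * x" using v by auto
      moreover have "(v - j * x) div w = k" using v by (intro div_nat_eqI) (auto simp: mult.commute)
      ultimately show "v \<in> {v \<in> {..<j * x + l * w}. f v = i}" using k by (simp add: f_def)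
    qed
    then show ?thesis by simp
  qed
  ultimately show ?thesis by blast
qed

text \<open>
  The sum of the squares of the part sizes is at most that of the Turan graph on as many vertices, so
  the complete multipartite graph has at least as many edges; deleting the surplus does not destroy
  any colouring.
\<close>

lemma unbalanced_multipartite:
  fixes j l x w s t :: nat
  assumes x: "0 < x" and w: "0 < w" and s: "s + 1 = j + l" "0 < s" and n: "j * x + l * w = s * t"
    and sq: "j * x\<^sup>2 + l * w\<^sup>2 \<le> s * t\<^sup>2"
  shows "\<exists>G :: nat ugraph. simple_graph G \<and> card (verts G) = s * t \<and>
    card (edges G) = card (edges (turan_graph s (s * t))) \<and> 2 ^ (j * x) \<le> num_colorings G (s + 1 + j)"
proof -
  obtain f where f: "\<And>v. v < s * t \<Longrightarrow> f v < j + l"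
    "\<And>i. i < j \<Longrightarrow> card {v \<in> {..<s * t}. f v = i} = x"
    "\<And>i. j \<le> i \<Longrightarrow> i < j + l \<Longrightarrow> card {v \<in> {..<s * t}. f v = i} = w"
    using exists_two_size_partition[OF x w, of j l] unfolding n by blast
  define H where "H = complete_multipartite {..<s * t} f"
  have sH: "simple_graph H" unfolding H_def by (intro simple_complete_multipartite) auto
  have "(\<Sum>i<j + l. (real (card {v \<in> {..<s * t}. f v = i}))\<^sup>2)
      = (\<Sum>i<j. (real x)\<^sup>2) + (\<Sum>i\<in>{j..<j + l}. (real w)\<^sup>2)"
  proof -
    have "{..<j + l} = {..<j} \<union> {j..<j + l}" by auto
    then have "(\<Sum>i<j + l. (real (card {v \<in> {..<s * t}. f v = i}))\<^sup>2) =
      (\<Sum>i<j. (real (card {v \<in> {..<s * t}. f v = i}))\<^sup>2) + (\<Sum>i\<in>{j..<j + l}. (real (card {v \<in> {..<s * t}. f v = i}))\<^sup>2)"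
      by (simp add: sum.union_disjoint ivl_disj_int)
    then show ?thesis using f by simp
  qed
  also have "\<dots> = real (j * x\<^sup>2 + l * w\<^sup>2)" by simp
  also have "\<dots> \<le> real (s * t\<^sup>2)" using sq by (simp only: of_nat_le_iff)
  finally have "(\<Sum>i<j + l. (real (card {v \<in> {..<s * t}. f v = i}))\<^sup>2) \<le> real s * (real t)\<^sup>2" by simp
  moreover have "real (2 * card (edges H)) = (real (s * t))\<^sup>2 - (\<Sum>i<j + l. (real (card {v \<in> {..<s * t}. f v = i}))\<^sup>2)"
    unfolding card_arcs[OF sH, symmetric] unfolding H_def arcs_complete_multipartite
    by (rule card_cross_pairs(1)) (use f in auto)
  moreover have "real (2 * card (edges (turan_graph s (s * t)))) = (real (s * t))\<^sup>2 - real s * (real t)\<^sup>2"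
  proof -
    have "(\<Sum>i<s. (real (card {v \<in> {..<s * t}. v mod s = i}))\<^sup>2) = (\<Sum>i<s. (real t)\<^sup>2)"
      using s card_turan_part[of _ s "s * t"] by (intro sum.cong) auto
    then show ?thesis
      unfolding card_arcs[OF simple_graph_turan_graph, symmetric]
      unfolding turan_graph_def arcs_complete_multipartite
      using card_cross_pairs(1)[of "{..<s * t}" "s * t" "\<lambda>v. v mod s" s] s by simp
  qed
  ultimately have "real (card (edges (turan_graph s (s * t)))) \<le> real (card (edges H))" by simp
  then obtain F where F: "F \<subseteq> edges H" "card F = card (edges (turan_graph s (s * t)))"
    using obtain_subset_with_card_n[of "card (edges (turan_graph s (s * t)))" "edges H"] by auto
  define G where "G = \<lparr>verts = {..<s * t}, edges = F\<rparr>"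
  have sG: "simple_graph G"
    using simple_graph_remove_edges[OF sH F(1)] by (simp add: G_def H_def complete_multipartite_def)
  define L where "L v = (if f v < j then {f v, s + 1 + f v} else {f v})" for v
  define D where "D = {v \<in> {..<s * t}. f v < j}"
  have cD: "card D = j * x"
  proof -
    have "D = (\<Union>i<j. {v \<in> {..<s * t}. f v = i})" by (auto simp: D_def)
    then have "card D = (\<Sum>i<j. card {v \<in> {..<s * t}. f v = i})"
      by (simp only:) (intro card_UN_disjoint, auto)
    then show ?thesis using f by simp
  qed
  have "2 ^ card D \<le> (\<Prod>v\<in>verts G. card (L v))"
    by (rule prod_ge_power_two) (auto simp: G_def D_def L_def)
  also have "\<dots> \<le> num_colorings G (s + 1 + j)"
  proof (rule prod_lists_le_num_colorings[OF sG])
    show "L v \<subseteq> {..<s + 1 + j}" if "v \<in> verts G" for v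
      using f(1)[of v] that s by (auto simp: L_def G_def)
    fix u v assume e: "{u, v} \<in> edges G"
    then have "{u, v} \<in> edges H" using F(1) by (auto simp: G_def)
    then have "f u \<noteq> f v" by (auto simp: H_def complete_multipartite_def doubleton_eq_iff)
    moreover have "f u < s + 1" "f v < s + 1"
      using f(1) s simple_graph_edge[OF sG e] by (auto simp: G_def)
    ultimately show "L u \<inter> L v = {}" by (auto simp: L_def)
  qed
  finally show ?thesis using sG F cD by (intro exI[of _ G]) (simp add: G_def)
qed

text \<open>
  The left side is the value, divided by \<open>j * l\<close>, of the quadratic form
  \<open>j * (l - 1) * x\<^sup>2 - 2 * j * l * x * w + l * (j - 1) * w\<^sup>2\<close> at \<open>x = (j + 1) * l\<close>, \<open>w = j * (l - 2)\<close>. After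
  the substitution \<open>j = 2 + u\<close>, \<open>l = 9 + v\<close> no monomial in \<open>u\<close> and \<open>v\<close> has a positive coefficient.
\<close>

lemma quadratic_gap:
  fixes j l :: int
  assumes "2 \<le> j" "9 \<le> l"
  shows "l * (l - 1) * (j + 1)\<^sup>2 - 2 * j * (j + 1) * l * (l - 2) + j * (j - 1) * (l - 2)\<^sup>2 \<le> - 1"
proof -
  define u v where "u = j - 2" and "v = l - 9"
  have uv: "j = 2 + u" "l = 9 + v" "0 \<le> u" "0 \<le> v" using assms by (auto simp: u_def v_def)
  have "l * (l - 1) * (j + 1)\<^sup>2 - 2 * j * (j + 1) * l * (l - 2) + j * (j - 1) * (l - 2)\<^sup>2
    = - (10 + 11 * v + v * v + u * (51 + 16 * v + v * v) + u * u * (5 + v))"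
    unfolding uv by (simp add: algebra_simps power2_eq_square)
  moreover have "0 \<le> v * v" "0 \<le> u * (51 + 16 * v + v * v)" "0 \<le> u * u * (5 + v)" using uv by auto
  ultimately show ?thesis using uv by linarith
qed

text \<open>
  Let \<open>s = j + l - 1\<close>. At \<open>X = (j + 1) * l\<close>, \<open>W = j * (l - 2)\<close> the exponents of the numbers of
  colourings agree, that is, \<open>j * s * X = (j + 1) * (j * X + l * W)\<close>. The edge condition says
  that \<open>j * (l - 1) * X\<^sup>2 - 2 * j * l * X * W + l * (j - 1) * W\<^sup>2\<close> is at most \<open>0\<close>, and at this point
  it is negative by the previous lemma. Scaling by a large \<open>Q\<close> makes enough room to increase \<open>X\<close> by one, which tips the balance of the exponents.
\<close>

lemma good_part_sizes:
  fixes j l :: nat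
  assumes j: "2 \<le> j" and l: "9 \<le> l"
  obtains X W where "0 < X" "0 < W"
    "(j + l - 1) * (j * X\<^sup>2 + l * W\<^sup>2) \<le> (j * X + l * W)\<^sup>2"
    "j * ((j + l - 1) * X) = (j + 1) * (j * X + l * W) + j * (l - 2)"
proof -
  define x0 where "x0 = (j + 1) * l"
  define w0 where "w0 = j * (l - 2)"
  define c where "c = 2 * j * (l - 1) * x0 + j * (l - 1)"
  define Q where "Q = c + 1"
  define J L A D E where "J = int j" and "L = int l" and "A = int x0" and "D = int w0" and "E = int Q"
  have JL: "2 \<le> J" "9 \<le> L" using j l by (auto simp: J_def L_def)
  have A: "A = (J + 1) * L" and D: "D = J * (L - 2)"
    using l by (auto simp: A_def D_def x0_def w0_def J_def L_def of_nat_diff algebra_simps)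
  have E: "E = 2 * J * (L - 1) * A + J * (L - 1) + 1"
    using l by (simp add: E_def Q_def c_def J_def L_def A_def of_nat_diff)
  have pos: "0 \<le> 2 * J * (L - 1) * A" "0 \<le> J * (L - 1)" "0 \<le> 2 * J * L * D * E" "0 \<le> J * L"
    using JL by (auto simp: A D E)
  have s: "int (j + l - 1) = J + L - 1" using j by (simp add: J_def L_def of_nat_diff)
  let ?B = "L * (L - 1) * (J + 1)\<^sup>2 - 2 * J * (J + 1) * L * (L - 2) + J * (J - 1) * (L - 2)\<^sup>2"
  have B: "J * L * ?B \<le> - 1"
  proof -
    have "1 * 1 \<le> J * L" using JL by (intro mult_mono) auto
    then have "J * L * ?B \<le> J * L * (- 1)" using quadratic_gap[OF JL] pos by (intro mult_left_mono) auto
    then show ?thesis using \<open>1 * 1 \<le> J * L\<close> by linarith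
  qed
  have "(J + L - 1) * (J * (A * E + 1)\<^sup>2 + L * (D * E)\<^sup>2) - (J * (A * E + 1) + L * (D * E))\<^sup>2
      = (J * (L - 1) * A\<^sup>2 - 2 * J * L * A * D + L * (J - 1) * D\<^sup>2) * E\<^sup>2
        + (2 * J * (L - 1) * A) * E + J * (L - 1) - 2 * J * L * D * E"
    by (simp add: algebra_simps power2_eq_square)
  also have "J * (L - 1) * A\<^sup>2 - 2 * J * L * A * D + L * (J - 1) * D\<^sup>2 = J * L * ?B"
    unfolding A D by (simp add: algebra_simps power2_eq_square)
  also have "J * L * ?B * E\<^sup>2 + (2 * J * (L - 1) * A) * E + J * (L - 1) - 2 * J * L * D * E \<le> 0"
  proof -
    have "J * L * ?B * E\<^sup>2 \<le> - 1 * E\<^sup>2" using B by (intro mult_right_mono) auto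
    moreover have "J * (L - 1) * 1 \<le> J * (L - 1) * E" using pos by (intro mult_left_mono) (auto simp: E)
    moreover have "E\<^sup>2 = (2 * J * (L - 1) * A) * E + (J * (L - 1)) * E + E"
      by (subst power2_eq_square, subst (1) E) (simp add: algebra_simps)
    moreover have "0 \<le> E" by (simp add: E_def)
    ultimately show ?thesis using pos by linarith
  qed
  finally have "int ((j + l - 1) * (j * (x0 * Q + 1)\<^sup>2 + l * (w0 * Q)\<^sup>2)) \<le> int ((j * (x0 * Q + 1) + l * (w0 * Q))\<^sup>2)"
    by (simp only: of_nat_mult s of_nat_add of_nat_power of_nat_1 J_def[symmetric] L_def[symmetric]
        A_def[symmetric] D_def[symmetric] E_def[symmetric] diff_le_0_iff_le)
  then have main: "(j + l - 1) * (j * (x0 * Q + 1)\<^sup>2 + l * (w0 * Q)\<^sup>2) \<le> (j * (x0 * Q + 1) + l * (w0 * Q))\<^sup>2"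
    by (simp only: of_nat_le_iff)
  have "J * ((J + L - 1) * (A * E + 1)) = (J + 1) * (J * (A * E + 1) + L * (D * E)) + J * (L - 2)"
    unfolding A D by (simp add: algebra_simps)
  then have "int (j * ((j + l - 1) * (x0 * Q + 1))) = int ((j + 1) * (j * (x0 * Q + 1) + l * (w0 * Q)) + w0)"
    by (simp only: of_nat_mult s of_nat_add of_nat_1 J_def[symmetric] L_def[symmetric]
        A_def[symmetric] D_def[symmetric] E_def[symmetric] D)
  then have "j * ((j + l - 1) * (x0 * Q + 1)) = (j + 1) * (j * (x0 * Q + 1) + l * (w0 * Q)) + j * (l - 2)"
    unfolding w0_def by (simp only: of_nat_eq_iff)
  moreover have "0 < w0 * Q" using j l by (simp add: w0_def Q_def)
  ultimately show ?thesis using main by (intro that[of "x0 * Q + 1" "w0 * Q"]) auto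
qed

text \<open>
  Scaling the part sizes by \<open>s * K\<close> makes the number of vertices divisible by \<open>s\<close> and increases the
  difference of the exponents to at least \<open>K\<close>; the value \<open>K = (s + 1) * q\<close> beats the constant
  factor \<open>(s + 1) ^ q\<close>.
\<close>

lemma lazebnik_conjecture_false:
  assumes s: "10 \<le> s" and q: "s + 3 \<le> q" "q \<le> 2 * s - 7"
  shows "\<not> lazebnik_conjecture s q"
proof
  assume conj: "lazebnik_conjecture s q"
  define j l where "j = q - s - 1" and "l = s + 1 - j"
  have jl: "2 \<le> j" "9 \<le> l" "s + 1 = j + l" "q = s + 1 + j" using s q by (auto simp: j_def l_def)
  then have sjl: "s = j + l - 1" by simp
  obtain X W where XW: "0 < X" "0 < W" "s * (j * X\<^sup>2 + l * W\<^sup>2) \<le> (j * X + l * W)\<^sup>2"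
    "j * (s * X) = (j + 1) * (j * X + l * W) + j * (l - 2)"
    by (rule good_part_sizes[OF jl(1,2)]) (simp only: sjl[symmetric])
  define K where "K = (s + 1) * q"
  define t where "t = K * (j * X + l * W)"
  have K: "0 < K" using s q by (simp add: K_def)
  have t: "0 < t" using K XW jl by (simp add: t_def)
  have n: "j * (s * K * X) + l * (s * K * W) = s * t" by (simp add: t_def algebra_simps)
  have "s * K\<^sup>2 * (s * (j * X\<^sup>2 + l * W\<^sup>2)) \<le> s * K\<^sup>2 * (j * X + l * W)\<^sup>2" using XW by (intro mult_left_mono) auto
  then have sq: "j * (s * K * X)\<^sup>2 + l * (s * K * W)\<^sup>2 \<le> s * t\<^sup>2"
    by (simp add: t_def algebra_simps power2_eq_square)
  have "\<exists>G :: nat ugraph. simple_graph G \<and> card (verts G) = s * t \<and>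
    card (edges G) = card (edges (turan_graph s (s * t))) \<and> 2 ^ (j * (s * K * X)) \<le> num_colorings G (s + 1 + j)"
    using XW K s by (intro unbalanced_multipartite[OF _ _ jl(3) _ n sq]) auto
  then obtain G :: "nat ugraph" where G: "simple_graph G" "card (verts G) = s * t"
    "card (edges G) = card (edges (turan_graph s (s * t)))" "2 ^ (j * (s * K * X)) \<le> num_colorings G q"
    using jl by auto
  have "j * (s * K * X) = K * (j * (s * X))" by simp
  also have "\<dots> = (j + 1) * t + K * (j * (l - 2))" unfolding XW(4) t_def by (simp add: algebra_simps)
  also have "\<dots> \<ge> (q - s) * t + K"
  proof -
    have "1 \<le> j * (l - 2)" using jl by (simp add: Suc_le_eq)
    then have "K * 1 \<le> K * (j * (l - 2))" by (intro mult_left_mono) auto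
    moreover have "q - s = j + 1" using jl by simp
    ultimately show ?thesis by simp
  qed
  finally have "(2::nat) ^ ((q - s) * t + K) \<le> 2 ^ (j * (s * K * X))" by (intro power_increasing) auto
  moreover have "(s + 1) ^ q < 2 ^ K"
    unfolding K_def power_mult using q by (intro power_strict_mono less_exp) auto
  then have "(s + 1) ^ q * 2 ^ ((q - s) * t) < 2 ^ ((q - s) * t + K)"
    by (simp add: power_add)
  moreover have "num_colorings (turan_graph s (s * t)) q \<le> (s + 1) ^ q * 2 ^ ((q - s) * t)"
    using s q t by (intro num_colorings_turan_le) auto
  ultimately have more: "num_colorings (turan_graph s (s * t)) q < num_colorings G q" using G(4) by linarith
  then have "\<not> graph_iso G (turan_graph s (s * t))"
    using num_colorings_iso_le[OF G(1) simple_graph_turan_graph] by (meson leD)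
  then have "num_colorings G q < num_colorings (turan_graph s (s * t)) q"
    using conj G s t unfolding lazebnik_conjecture_def by (metis dvd_triv_left nat_0_less_mult_iff less_le_trans zero_less_numeral)
  then show False using more by simp
qed

theorem theorem1p5:
  fixes s q :: nat
  shows
    "(1 < s \<and> s \<le> q \<and> q \<le> s + 2 \<longrightarrow>
       (\<forall>\<epsilon>::real. \<epsilon> > 0 \<longrightarrow>
         (\<exists>\<eta>::real. \<eta> > 0 \<and> (\<exists>n\<^sub>0::nat. \<forall>n\<ge>n\<^sub>0. \<forall>G :: nat ugraph.
            extremal q G \<and> card (verts G) = n \<and> (q = s \<longrightarrow> num_colorings G q > 0) \<and>
            \<bar>real (card (edges G)) - (real s - 1) / (2 * real s) * (real n)\<^sup>2\<bar> \<le> \<eta> * (real n)\<^sup>2 \<longrightarrow>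
            close_to (\<epsilon> * (real n)\<^sup>2) G (turan_graph s n)))))
     \<and>
     (10 \<le> s \<and> s + 3 \<le> q \<and> q \<le> 2 * s - 7 \<longrightarrow> \<not> lazebnik_conjecture s q)"
  using extremal_graphs_near_turan[of s q] lazebnik_conjecture_false[of s q] by blast

end
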